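(* Let $r$ be a sufficiently large even constant, and let $n$ be such that $4 \mid n$, $r \mid n$ and $n/r$ is even. Let $f_{\textsf{PRY}} = f_{\sf RY}(B_1)\cdot f_{\sf RY}(B_2)\cdots f_{\sf RY}(B_{n/r})$ be as defined in the context. Then $f_{\textsf{PRY}}$ is computable by a read-$k$ formula for a constant $k$ (depending only on $r$), and if $f_1,\ldots,f_s$ are read-once polynomials in the variables $X$ over the field $\mathbb{G}=\mathbb{F}(W)$ such that $f_{\textsf{PRY}} = f_1+f_2+\cdots+f_s$, then $s = 2^{\Omega(n)}$.
   Context: $\mathbb{F}$ is a field, $X=\{x_1,\ldots,x_n\}$ and $W=\{w_{i,\ell,j}\}$ is a set of auxiliary variables; $\mathbb{G}=\mathbb{F}(W)$ is the field of rational functions in $W$, and polynomials are regarded as elements of $\mathbb{G}[X]$. Raz–Yehudayoff polynomials: for indices $i\le j$ with $j-i+1$ even define $f_{i,j}$ inductively by $f_{i,i-1}=1$ (empty interval) and, for $j-i+1\ge 2$ even, $f_{i,j}=(1+x_ix_j)f_{i+1,j-1}+\sum_{\ell} w_{i,\ell,j}\, f_{i,\ell}\, f_{\ell+1,j}$, where the sum ranges over $\ell$ with $i<\ell<j-1$ such that $[i,\ell]$ and $[\ell+1,j]$ both have even (positive) length. For $1\le b\le n/r$ let $B_b=\{x_{(b-1)r+1},\ldots,x_{br}\}$ and $f_{\sf RY}(B_b)=f_{(b-1)r+1,\,br}$. A read-once formula (ROF) is an arithmetic formula (tree-shaped circuit with $+$ and $\times$ gates, leaves labeled by variables or field constants)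 in which every variable labels at most one leaf; a read-once polynomial is one computed by an ROF. A read-$k$ formula is a formula in which every variable labels at most $k$ leaves. *)

theory Defs
  imports
    Complex_Main
    "HOL-Library.Poly_Mapping"
    "HOL-Library.Nat_Bijection"
    "HOL-Computational_Algebra.Fraction_Field"
begin

text \<open>Polynomials in the variables \<^typ>\<open>'v\<close>: finitely supported maps from monomials
  (exponent vectors) to coefficients, with the ring structure from \<^theory>\<open>HOL-Library.Poly_Mapping\<close>.\<close>

type_synonym ('v, 'c) mpoly = "('v \<Rightarrow>\<^sub>0 nat) \<Rightarrow>\<^sub>0 'c"

definition mvar :: "'v \<Rightarrow> ('v, 'c::comm_ring_1) mpoly" where
  "mvar v = Poly_Mapping.single (Poly_Mapping.single v 1) 1"

definition mconst :: "'c \<Rightarrow> ('v, 'c::comm_ring_1) mpoly" where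
  "mconst c = Poly_Mapping.single 0 c"

text \<open>The variables \<open>x\<^sub>i\<close> are indexed by \<^typ>\<open>nat\<close>; the auxiliary variables are
  \<open>w\<^bsub>i,l,j\<^esub>\<close>. The linear order on the latter has no mathematical content: it only serves to
  make \<open>\<F>[W]\<close> an instance of \<^class>\<open>idom\<close>.\<close>

datatype wvar = W nat nat nat

fun wvar_code :: "wvar \<Rightarrow> nat" where
  "wvar_code (W i l j) = prod_encode (i, prod_encode (l, j))"

lemma wvar_code_eq_iff: "wvar_code u = wvar_code v \<longleftrightarrow> u = v"
  by (cases u; cases v) auto

instantiation wvar :: linorder
begin

definition less_eq_wvar :: "wvar \<Rightarrow> wvar \<Rightarrow> bool" where
  "u \<le> v \<longleftrightarrow> wvar_code u \<le> wvar_code v"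

definition less_wvar :: "wvar \<Rightarrow> wvar \<Rightarrow> bool" where
  "u < v \<longleftrightarrow> wvar_code u < wvar_code v"

instance
  by intro_classes (auto simp: less_eq_wvar_def less_wvar_def wvar_code_eq_iff)

end

text \<open>\<open>\<G> = \<F>(W)\<close> and \<open>\<G>[X]\<close>.\<close>

type_synonym 'a ratfunW = "(wvar, 'a) mpoly fract"

type_synonym 'a polyX = "(nat, 'a ratfunW) mpoly"

definition wcoeff :: "nat \<Rightarrow> nat \<Rightarrow> nat \<Rightarrow> 'a::field ratfunW" where
  "wcoeff i l j = Fract (mvar (W i l j)) 1"

text \<open>Only intervals \<open>[i, j]\<close> of even length matter, i.e. \<open>even (Suc j - i)\<close>; for these the
  recursion reaches only intervals of even length, and the case \<open>j < i\<close> is the empty interval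
  \<open>j = i - 1\<close>. Values at odd lengths are junk.\<close>

function ry :: "nat \<Rightarrow> nat \<Rightarrow> 'a::field polyX" where
  "ry i j =
    (if j < i then 1
     else (1 + mvar i * mvar j) * ry (i + 1) (j - 1)
        + (\<Sum>l | i < l \<and> l < j - 1 \<and> even (l - i + 1) \<and> even (j - l).
             mconst (wcoeff i l j) * ry i l * ry (l + 1) j))"
  by pat_completeness auto
termination
  by (relation "measure (\<lambda>(i, j). Suc j - i)") auto

declare ry.simps [simp del]

definition pry :: "nat \<Rightarrow> nat \<Rightarrow> 'a::field polyX" where
  "pry r n = (\<Prod>b = 1..n div r. ry ((b - 1) * r + 1) (b * r))"

datatype ('v, 'c) formula =
    Var 'v
  | Const 'c
  | Add "('v, 'c) formula" "('v, 'c) formula"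
  | Mult "('v, 'c) formula" "('v, 'c) formula"

primrec poly_of :: "('v, 'c::comm_ring_1) formula \<Rightarrow> ('v, 'c) mpoly" where
  "poly_of (Var v) = mvar v"
| "poly_of (Const c) = mconst c"
| "poly_of (Add p q) = poly_of p + poly_of q"
| "poly_of (Mult p q) = poly_of p * poly_of q"

primrec leaf_count :: "'v \<Rightarrow> ('v, 'c) formula \<Rightarrow> nat" where
  "leaf_count x (Var v) = (if v = x then 1 else 0)"
| "leaf_count x (Const c) = 0"
| "leaf_count x (Add p q) = leaf_count x p + leaf_count x q"
| "leaf_count x (Mult p q) = leaf_count x p + leaf_count x q"

text \<open>Leaves are labelled by variables in \<open>X\<close> or constants; the first type parameter of
  \<^type>\<open>formula\<close> occurs only at \<^const>\<open>Var\<close>, so \<^const>\<open>set1_formula\<close> is the set of variables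
  that label a leaf.\<close>

definition read_formula :: "nat \<Rightarrow> 'v set \<Rightarrow> ('v, 'c) formula \<Rightarrow> bool" where
  "read_formula k X p \<longleftrightarrow> set1_formula p \<subseteq> X \<and> (\<forall>x. leaf_count x p \<le> k)"

definition read_computable :: "nat \<Rightarrow> 'v set \<Rightarrow> ('v, 'c::comm_ring_1) mpoly \<Rightarrow> bool" where
  "read_computable k X f \<longleftrightarrow> (\<exists>p. read_formula k X p \<and> poly_of p = f)"

abbreviation read_once_poly :: "'v set \<Rightarrow> ('v, 'c::comm_ring_1) mpoly \<Rightarrow> bool" where
  "read_once_poly \<equiv> read_computable 1"

end

theory Submission
  imports Defs
begin

text \<open>For a set \<open>Y\<close> of variables let \<open>rk\<^sub>Y f\<close> be the rank of the matrix of multilinear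
  coefficients of \<open>f\<close>, with rows the subsets of \<open>Y\<close> and columns the subsets of its complement. It is
  subadditive, and multiplicative for products in disjoint variables; so if \<open>Y\<close> is uniformly random,
  the expected rank of a read-once polynomial is subadditive at sum gates and, by independence,
  multiplicative at product gates. Starting from the trivial bound
  \<open>rk\<^sub>Y f \<le> 2 ^ min \<bar>Y\<bar> (n - \<bar>Y\<bar>)\<close> for at most five variables, an induction over the formula
  shows that this expectation is at most \<open>(7/5) ^ n\<close>, and \<open>7/5\<close> is smaller than \<open>sqrt 2\<close>.

  On the other hand, if \<open>Y\<close> contains exactly half of the variables of each block, then the product
  of the Raz--Yehudayoff polynomials has full rank \<open>2 ^ (n/2)\<close>, and this happens with probability at
  least \<open>(1/r) ^ (n/r)\<close>. Full rank on a balanced interval \<open>[i, j]\<close> is shown by induction: if \<open>Y\<close>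
  separates \<open>i\<close> from \<open>j\<close>, the part free of the variables \<open>w\<^bsub>i,l,j\<^esub>\<close> is already nonsingular;
  otherwise some \<open>l\<close> splits the interval into two balanced ones, and the part of degree 1 in
  \<open>w\<^bsub>i,l,j\<^esub>\<close> is nonsingular. Comparing expectations gives
  \<open>s * (7/5) ^ n \<ge> (1/r) ^ (n/r) * 2 ^ (n/2)\<close>.\<close>

section \<open>Multilinear coefficients\<close>

text \<open>For infinite \<open>A\<close> the sum collapses to the monomial 1; hence the finiteness
  hypotheses wherever a set is to be recovered from its monomial.\<close>

definition sqfree_mon :: "'v set \<Rightarrow> 'v \<Rightarrow>\<^sub>0 nat" where
  "sqfree_mon A = (\<Sum>a\<in>A. Poly_Mapping.single a 1)"

definition mlcoeff :: "('v, 'c::zero) mpoly \<Rightarrow> 'v set \<Rightarrow> 'c" where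
  "mlcoeff f A = Poly_Mapping.lookup f (sqfree_mon A)"

definition vars_in :: "'v set \<Rightarrow> ('v, 'c::zero) mpoly \<Rightarrow> bool" where
  "vars_in U f \<longleftrightarrow> (\<forall>m\<in>Poly_Mapping.keys f. Poly_Mapping.keys m \<subseteq> U)"

lemma lookup_sqfree_mon: "finite A \<Longrightarrow> Poly_Mapping.lookup (sqfree_mon A) x = (if x \<in> A then 1 else 0)"
  by (induction A rule: finite_induct)
    (auto simp: sqfree_mon_def lookup_add lookup_single when_def)

lemma keys_sqfree_mon: "finite A \<Longrightarrow> Poly_Mapping.keys (sqfree_mon A) = A"
  by (auto simp: in_keys_iff lookup_sqfree_mon split: if_splits)

lemma sqfree_mon_empty [simp]: "sqfree_mon {} = 0"
  by (simp add: sqfree_mon_def)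

lemma sqfree_mon_inj: "finite A \<Longrightarrow> finite B \<Longrightarrow> sqfree_mon A = sqfree_mon B \<longleftrightarrow> A = B"
  by (metis keys_sqfree_mon)

lemma poly_mapping_sum_single:
  fixes f :: "'a \<Rightarrow>\<^sub>0 'b::comm_monoid_add"
  shows "f = (\<Sum>m\<in>Poly_Mapping.keys f. Poly_Mapping.single m (Poly_Mapping.lookup f m))"
proof (rule poly_mapping_eqI)
  fix k
  show "Poly_Mapping.lookup f k = Poly_Mapping.lookup (\<Sum>m\<in>Poly_Mapping.keys f. Poly_Mapping.single m (Poly_Mapping.lookup f m)) k"
    by (cases "k \<in> Poly_Mapping.keys f") (simp_all add: lookup_sum lookup_single when_def not_in_keys_iff_lookup_eq_zero)
qed

lemma lookup_times_sum:
  fixes f g :: "('a::cancel_comm_monoid_add) \<Rightarrow>\<^sub>0 'b::comm_semiring_0"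
  shows "Poly_Mapping.lookup (f * g) k =
    (\<Sum>m\<in>Poly_Mapping.keys f. \<Sum>m'\<in>Poly_Mapping.keys g. (Poly_Mapping.lookup f m * Poly_Mapping.lookup g m' when m + m' = k))"
proof -
  have "f * g = (\<Sum>m\<in>Poly_Mapping.keys f. Poly_Mapping.single m (Poly_Mapping.lookup f m)) *
      (\<Sum>m\<in>Poly_Mapping.keys g. Poly_Mapping.single m (Poly_Mapping.lookup g m))"
    using poly_mapping_sum_single[of f] poly_mapping_sum_single[of g] by simp
  also have "\<dots> = (\<Sum>m\<in>Poly_Mapping.keys f. \<Sum>m'\<in>Poly_Mapping.keys g. Poly_Mapping.single (m + m') (Poly_Mapping.lookup f m * Poly_Mapping.lookup g m'))"
    by (simp add: sum_product mult_single)
  finally show ?thesis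
    by (simp add: lookup_sum lookup_single)
qed

lemma vars_in_mono: "vars_in U f \<Longrightarrow> U \<subseteq> V \<Longrightarrow> vars_in V f"
  by (auto simp: vars_in_def)

lemma vars_in_add: "vars_in U f \<Longrightarrow> vars_in U g \<Longrightarrow> vars_in U (f + g)"
  using keys_add[of f g] by (auto simp: vars_in_def)

lemma vars_in_mult: "vars_in U f \<Longrightarrow> vars_in U g \<Longrightarrow> vars_in U (f * g)"
  for f g :: "('v, 'c::comm_ring_1) mpoly"
proof -
  assume a: "vars_in U f" "vars_in U g"
  have "Poly_Mapping.keys m \<subseteq> U" if "m \<in> Poly_Mapping.keys (f * g)" for m
  proof -
    from that keys_mult[of f g] obtain p q where "m = p + q" "p \<in> Poly_Mapping.keys f" "q \<in> Poly_Mapping.keys g" by blast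
    with a keys_add[of p q] show ?thesis unfolding vars_in_def by blast
  qed
  then show ?thesis by (auto simp: vars_in_def)
qed

lemma vars_in_mconst [simp]: "vars_in U (mconst c)"
  by (auto simp: vars_in_def mconst_def)

lemma vars_in_one [simp]: "vars_in U (1 :: ('v, 'c::comm_ring_1) mpoly)"
  by (simp add: vars_in_def)

lemma vars_in_zero [simp]: "vars_in U (0 :: ('v, 'c::comm_ring_1) mpoly)"
  by (simp add: vars_in_def)

lemma vars_in_mvar: "v \<in> U \<Longrightarrow> vars_in U (mvar v :: ('v, 'c::comm_ring_1) mpoly)"
  by (auto simp: vars_in_def mvar_def)

lemma vars_in_sum: "(\<And>i. i \<in> I \<Longrightarrow> vars_in U (f i)) \<Longrightarrow> vars_in U (\<Sum>i\<in>I. f i)"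
  for f :: "'i \<Rightarrow> ('v, 'c::comm_ring_1) mpoly"
  by (induction I rule: infinite_finite_induct) (auto intro: vars_in_add)

lemma vars_in_poly_of: "vars_in (set1_formula p) (poly_of p)"
  by (induction p) (auto intro!: vars_in_add vars_in_mult intro: vars_in_mono vars_in_mvar)

lemma mlcoeff_zero_outside:
  "vars_in U f \<Longrightarrow> finite A \<Longrightarrow> \<not> A \<subseteq> U \<Longrightarrow> mlcoeff f A = 0"
  unfolding vars_in_def mlcoeff_def
  by (metis keys_sqfree_mon not_in_keys_iff_lookup_eq_zero)

lemma mlcoeff_add: "mlcoeff (f + g) A = mlcoeff f A + mlcoeff g A"
  by (simp add: mlcoeff_def lookup_add)

lemma mlcoeff_sum: "mlcoeff (\<Sum>i\<in>I. f i) A = (\<Sum>i\<in>I. mlcoeff (f i) A)"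
  by (simp add: mlcoeff_def lookup_sum)

lemma lookup_mconst_mult: "Poly_Mapping.lookup (mconst c * f) m = c * Poly_Mapping.lookup f m"
  for f :: "('v, 'c::comm_ring_1) mpoly"
proof -
  have "Poly_Mapping.lookup (mconst c * f) m = (\<Sum>m'\<in>Poly_Mapping.keys f. c * Poly_Mapping.lookup f m' when m' = m)"
    by (cases "c = 0") (simp_all add: mconst_def lookup_times_sum)
  also have "\<dots> = c * Poly_Mapping.lookup f m"
    by (cases "m \<in> Poly_Mapping.keys f") (simp_all add: when_def not_in_keys_iff_lookup_eq_zero)
  finally show ?thesis .
qed

lemma mlcoeff_mconst_mult: "mlcoeff (mconst c * f) A = c * mlcoeff f A"
  for f :: "('v, 'c::comm_ring_1) mpoly"
  by (simp add: mlcoeff_def lookup_mconst_mult)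

lemma mlcoeff_mconst: "finite A \<Longrightarrow> mlcoeff (mconst c) A = (if A = {} then c else 0)"
  using sqfree_mon_inj[of A "{}"]
  by (auto simp: mlcoeff_def mconst_def lookup_single when_def)

lemma mlcoeff_one: "finite A \<Longrightarrow> mlcoeff (1 :: ('v, 'c::comm_ring_1) mpoly) A = (if A = {} then 1 else 0)"
  using mlcoeff_mconst[of A 1] by (simp add: mconst_def)

lemma mlcoeff_mvar_mult_mvar:
  assumes "i \<noteq> j" "finite A"
  shows "mlcoeff (mvar i * mvar j :: ('v, 'c::comm_ring_1) mpoly) A = (if A = {i, j} then 1 else 0)"
proof -
  have "sqfree_mon {i, j} = Poly_Mapping.single i 1 + Poly_Mapping.single j 1"
    using assms by (simp add: sqfree_mon_def)
  with assms sqfree_mon_inj[of "{i,j}" A] show ?thesis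
    by (auto simp: mlcoeff_def mvar_def mult_single lookup_single when_def)
qed

text \<open>Since \<open>U\<close> and \<open>V\<close> are disjoint, the exponent of each variable
  comes from one factor only, so a squarefree monomial splits in exactly one way.\<close>

lemma add_eq_sqfree_mon_iff:
  fixes m m' :: "'v \<Rightarrow>\<^sub>0 nat"
  assumes "Poly_Mapping.keys m \<subseteq> U" "Poly_Mapping.keys m' \<subseteq> V" "U \<inter> V = {}" "finite A" "A \<subseteq> U \<union> V"
  shows "m + m' = sqfree_mon A \<longleftrightarrow> m = sqfree_mon (A \<inter> U) \<and> m' = sqfree_mon (A \<inter> V)"
proof
  assume eq: "m + m' = sqfree_mon A"
  have l: "Poly_Mapping.lookup m x + Poly_Mapping.lookup m' x = (if x \<in> A then 1 else 0)" for x
    using arg_cong[OF eq, of "\<lambda>p. Poly_Mapping.lookup p x"] assms(4) by (simp add: lookup_add lookup_sqfree_mon)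
  have z: "x \<notin> U \<Longrightarrow> Poly_Mapping.lookup m x = 0" "x \<notin> V \<Longrightarrow> Poly_Mapping.lookup m' x = 0" for x
    using assms(1,2) by (auto simp: in_keys_iff subset_iff)
  show "m = sqfree_mon (A \<inter> U) \<and> m' = sqfree_mon (A \<inter> V)"
  proof (intro conjI poly_mapping_eqI)
    fix x
    show "Poly_Mapping.lookup m x = Poly_Mapping.lookup (sqfree_mon (A \<inter> U)) x"
      using l[of x] z[of x] assms by (cases "x \<in> U"; cases "x \<in> V") (auto simp: lookup_sqfree_mon split: if_splits)
    show "Poly_Mapping.lookup m' x = Poly_Mapping.lookup (sqfree_mon (A \<inter> V)) x"
      using l[of x] z[of x] assms by (cases "x \<in> U"; cases "x \<in> V") (auto simp: lookup_sqfree_mon split: if_splits)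
  qed
next
  assume "m = sqfree_mon (A \<inter> U) \<and> m' = sqfree_mon (A \<inter> V)"
  moreover have "sqfree_mon (A \<inter> U) + sqfree_mon (A \<inter> V) = sqfree_mon A"
    by (rule poly_mapping_eqI) (use assms in \<open>auto simp: lookup_add lookup_sqfree_mon\<close>)
  ultimately show "m + m' = sqfree_mon A" by simp
qed

text \<open>By the unique splitting of a squarefree monomial, a single pair of monomials survives in
  the convolution. Both the multiplicativity of rank and the Kronecker structure used later rest on
  this.\<close>

lemma mlcoeff_mult:
  fixes f g :: "('v, 'c::comm_ring_1) mpoly"
  assumes "vars_in U f" "vars_in V g" "U \<inter> V = {}" "finite A" "A \<subseteq> U \<union> V"
  shows "mlcoeff (f * g) A = mlcoeff f (A \<inter> U) * mlcoeff g (A \<inter> V)"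
proof -
  have sel: "(\<Sum>m\<in>Poly_Mapping.keys h. Poly_Mapping.lookup h m when m = k) = Poly_Mapping.lookup h k" for h :: "('v, 'c) mpoly" and k
    by (cases "k \<in> Poly_Mapping.keys h") (simp_all add: when_def not_in_keys_iff_lookup_eq_zero)
  have "mlcoeff (f * g) A =
     (\<Sum>m\<in>Poly_Mapping.keys f. \<Sum>m'\<in>Poly_Mapping.keys g. (Poly_Mapping.lookup f m when m = sqfree_mon (A \<inter> U)) *
        (Poly_Mapping.lookup g m' when m' = sqfree_mon (A \<inter> V)))"
    unfolding mlcoeff_def lookup_times_sum
  proof (intro sum.cong refl)
    fix m m' assume "m \<in> Poly_Mapping.keys f" "m' \<in> Poly_Mapping.keys g"
    then have "m + m' = sqfree_mon A \<longleftrightarrow> m = sqfree_mon (A \<inter> U) \<and> m' = sqfree_mon (A \<inter> V)"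
      using assms by (intro add_eq_sqfree_mon_iff) (auto simp: vars_in_def)
    then show "(Poly_Mapping.lookup f m * Poly_Mapping.lookup g m' when m + m' = sqfree_mon A) =
       (Poly_Mapping.lookup f m when m = sqfree_mon (A \<inter> U)) * (Poly_Mapping.lookup g m' when m' = sqfree_mon (A \<inter> V))"
      by (simp add: when_def)
  qed
  also have "\<dots> = mlcoeff f (A \<inter> U) * mlcoeff g (A \<inter> V)"
    by (simp add: sum_product[symmetric] sel mlcoeff_def)
  finally show ?thesis .
qed

section \<open>The upper bound for read-once formulas\<close>

text \<open>The rank of the coefficient matrix with rows the subsets of \<open>Y\<close> and columns the sets
  disjoint from \<open>Y\<close>.\<close>

definition rank_le :: "'v set \<Rightarrow> nat \<Rightarrow> ('v, 'c::comm_ring_1) mpoly \<Rightarrow> bool" where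
  "rank_le Y K f \<longleftrightarrow> (\<exists>u v. \<forall>A B. finite A \<longrightarrow> finite B \<longrightarrow> A \<subseteq> Y \<longrightarrow> B \<inter> Y = {} \<longrightarrow>
     mlcoeff f (A \<union> B) = (\<Sum>k<K. u k A * v k B))"

text \<open>Unlike the rank itself, this bound is preserved when a constant is added to or multiplied
  with the polynomial, so constant leaves come for free.\<close>

definition affine_rank_le :: "'v set \<Rightarrow> nat \<Rightarrow> ('v, 'c::comm_ring_1) mpoly \<Rightarrow> bool" where
  "affine_rank_le Y K f \<longleftrightarrow> (\<forall>c d. rank_le Y K (mconst d * f + mconst c))"

section \<open>Rank of coefficient matrices under sums and products\<close>

text \<open>Lets the rank-one terms be indexed by an arbitrary finite set; if it has fewer than
  \<open>K\<close> elements, the factorization is padded with zeros.\<close>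

lemma rank_leI:
  assumes "finite I" "card I \<le> K"
    and eq: "\<And>A B. finite A \<Longrightarrow> finite B \<Longrightarrow> A \<subseteq> Y \<Longrightarrow> B \<inter> Y = {} \<Longrightarrow>
      mlcoeff f (A \<union> B) = (\<Sum>i\<in>I. u i A * v i B)"
  shows "rank_le Y K f"
proof -
  obtain h where h: "bij_betw h {..<card I} I"
    using ex_bij_betw_nat_finite[OF assms(1)] by (auto simp: lessThan_atLeast0)
  define u' where "u' k A = (if k < card I then u (h k) A else 0)" for k A
  have "(\<Sum>k<K. u' k A * v (h k) B) = (\<Sum>i\<in>I. u i A * v i B)" for A B
  proof -
    have "(\<Sum>k<K. u' k A * v (h k) B) = (\<Sum>k<card I. u' k A * v (h k) B)"
      using assms(2) by (intro sum.mono_neutral_right) (auto simp: u'_def)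
    also have "\<dots> = (\<Sum>k<card I. u (h k) A * v (h k) B)" by (simp add: u'_def)
    also have "\<dots> = (\<Sum>i\<in>I. u i A * v i B)"
      by (rule sum.reindex_bij_betw[OF h])
    finally show ?thesis .
  qed
  then show ?thesis unfolding rank_le_def using eq
    by (intro exI[of _ u'] exI[of _ "\<lambda>k. v (h k)"]) simp
qed

lemma rank_leE:
  assumes "rank_le Y K f"
  obtains u v where "\<And>A B. finite A \<Longrightarrow> finite B \<Longrightarrow> A \<subseteq> Y \<Longrightarrow> B \<inter> Y = {} \<Longrightarrow>
      mlcoeff f (A \<union> B) = (\<Sum>k<K. u k A * v k B)"
  using assms unfolding rank_le_def by blast

lemma rank_le_add:
  assumes "rank_le Y K f" "rank_le Y L g"
  shows "rank_le Y (K + L) (f + g)"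
proof -
  obtain u v u' v' where
    f: "\<And>A B. finite A \<Longrightarrow> finite B \<Longrightarrow> A \<subseteq> Y \<Longrightarrow> B \<inter> Y = {} \<Longrightarrow>
      mlcoeff f (A \<union> B) = (\<Sum>k<K. u k A * v k B)" and
    g: "\<And>A B. finite A \<Longrightarrow> finite B \<Longrightarrow> A \<subseteq> Y \<Longrightarrow> B \<inter> Y = {} \<Longrightarrow>
      mlcoeff g (A \<union> B) = (\<Sum>k<L. u' k A * v' k B)"
    using assms by (elim rank_leE) blast
  show ?thesis
  proof (rule rank_leI[of "{..<K} <+> {..<L}" _ _ _ "case_sum u u'" "case_sum v v'"])
    show "card ({..<K} <+> {..<L}) \<le> K + L" by (simp add: card_Plus)
  qed (simp_all add: mlcoeff_add f g sum.Plus)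
qed

lemma rank_le_sum:
  "finite I \<Longrightarrow> (\<And>i. i \<in> I \<Longrightarrow> rank_le Y (K i) (f i)) \<Longrightarrow> rank_le Y (\<Sum>i\<in>I. K i) (\<Sum>i\<in>I. f i)"
proof (induction I rule: finite_induct)
  case empty
  show ?case by (rule rank_leI[of "{}"]) (auto simp: mlcoeff_def)
qed (auto intro: rank_le_add)

lemma rank_le_mconst: "rank_le Y 1 (mconst c)"
  by (rule rank_leI[of "{()}" _ _ _ "\<lambda>_ A. if A = {} then c else 0" "\<lambda>_ B. if B = {} then 1 else 0"])
    (auto simp: mlcoeff_mconst)

lemma rank_le_mconst_mult:
  assumes "rank_le Y K f"
  shows "rank_le Y K (mconst c * f)"
proof -
  obtain u v where
    f: "\<And>A B. finite A \<Longrightarrow> finite B \<Longrightarrow> A \<subseteq> Y \<Longrightarrow> B \<inter> Y = {} \<Longrightarrow>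
      mlcoeff f (A \<union> B) = (\<Sum>k<K. u k A * v k B)"
    using assms by (elim rank_leE) blast
  show ?thesis
    by (rule rank_leI[of "{..<K}" _ _ _ "\<lambda>k A. c * u k A" v])
      (simp_all add: mlcoeff_mconst_mult f sum_distrib_left mult.assoc)
qed

text \<open>The Kronecker product of the two factorizations, with terms indexed by pairs.\<close>

lemma rank_le_mult:
  fixes f g :: "('v, 'c::comm_ring_1) mpoly"
  assumes "rank_le Y K f" "rank_le Y L g" and vars: "vars_in U f" "vars_in V g" "U \<inter> V = {}"
  shows "rank_le Y (K * L) (f * g)"
proof -
  obtain u v u' v' where
    f: "\<And>A B. finite A \<Longrightarrow> finite B \<Longrightarrow> A \<subseteq> Y \<Longrightarrow> B \<inter> Y = {} \<Longrightarrow>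
      mlcoeff f (A \<union> B) = (\<Sum>k<K. u k A * v k B)" and
    g: "\<And>A B. finite A \<Longrightarrow> finite B \<Longrightarrow> A \<subseteq> Y \<Longrightarrow> B \<inter> Y = {} \<Longrightarrow>
      mlcoeff g (A \<union> B) = (\<Sum>k<L. u' k A * v' k B)"
    using assms by (elim rank_leE) blast
  \<comment> \<open>Intersecting with \<open>U\<close> and \<open>V\<close> forgets the elements
    outside \<open>U \<union> V\<close>. The indicator restores the coefficient 0 that such sets
    have.\<close>
  define s where "s A = (if A \<subseteq> U \<union> V then 1 else (0::'c))" for A
  show ?thesis
  proof (rule rank_leI[of "{..<K} \<times> {..<L}" _ _ _
        "\<lambda>(k, l) A. s A * (u k (A \<inter> U) * u' l (A \<inter> V))"
        "\<lambda>(k, l) B. s B * (v k (B \<inter> U) * v' l (B \<inter> V))"])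
    fix A B :: "'v set"
    assume ab: "finite A" "finite B" "A \<subseteq> Y" "B \<inter> Y = {}"
    have "mlcoeff (f * g) (A \<union> B) =
       s A * s B * (\<Sum>k<K. u k (A \<inter> U) * v k (B \<inter> U)) * (\<Sum>k<L. u' k (A \<inter> V) * v' k (B \<inter> V))"
    proof (cases "A \<union> B \<subseteq> U \<union> V")
      case True
      have "mlcoeff (f * g) (A \<union> B) = mlcoeff f ((A \<union> B) \<inter> U) * mlcoeff g ((A \<union> B) \<inter> V)"
        using True ab vars by (intro mlcoeff_mult) auto
      also have "\<dots> = mlcoeff f ((A \<inter> U) \<union> (B \<inter> U)) * mlcoeff g ((A \<inter> V) \<union> (B \<inter> V))"
        by (simp add: Int_Un_distrib2)
      also have "\<dots> = (\<Sum>k<K. u k (A \<inter> U) * v k (B \<inter> U)) * (\<Sum>k<L. u' k (A \<inter> V) * v' k (B \<inter> V))"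
        using ab by (subst f, simp, simp, blast, blast, subst g) auto
      finally show ?thesis using True by (simp add: s_def)
    next
      case False
      have "vars_in (U \<union> V) (f * g)"
        using vars by (intro vars_in_mult) (auto intro: vars_in_mono)
      with False ab mlcoeff_zero_outside have "mlcoeff (f * g) (A \<union> B) = 0" by blast
      moreover have "s A * s B = 0" using False by (auto simp: s_def)
      ultimately show ?thesis by simp
    qed
    also have "\<dots> = (\<Sum>(k, l)\<in>{..<K} \<times> {..<L}. s A * (u k (A \<inter> U) * u' l (A \<inter> V)) * (s B * (v k (B \<inter> U) * v' l (B \<inter> V))))"
      unfolding mult.assoc[of "s A * s B"] unfolding sum_product
      unfolding sum.cartesian_product sum_distrib_left
      by (intro sum.cong) (auto simp: mult_ac)
    finally show "mlcoeff (f * g) (A \<union> B) = (\<Sum>i\<in>{..<K} \<times> {..<L}.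
        (case i of (k, l) \<Rightarrow> \<lambda>A. s A * (u k (A \<inter> U) * u' l (A \<inter> V))) A *
        (case i of (k, l) \<Rightarrow> \<lambda>B. s B * (v k (B \<inter> U) * v' l (B \<inter> V))) B)"
      by (simp add: case_prod_unfold)
  qed simp_all
qed

text \<open>The rank is at most the number of nonzero rows and at most the number of nonzero
  columns. In each case one of the two factors consists of unit vectors.\<close>

lemma rank_le_generic:
  fixes f :: "('v, 'c::comm_ring_1) mpoly"
  assumes "vars_in U f" "finite U"
  shows "rank_le Y (2 ^ min (card (Y \<inter> U)) (card (U - Y))) f"
proof -
  have 1: "rank_le Y (2 ^ card (Y \<inter> U)) f"
  proof (rule rank_leI[of "Pow (Y \<inter> U)" _ _ _ "\<lambda>C A. if A = C then 1 else 0" "\<lambda>C B. mlcoeff f (C \<union> B)"])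
    fix A B :: "'v set"
    assume ab: "finite A" "finite B" "A \<subseteq> Y" "B \<inter> Y = {}"
    have "(\<Sum>C\<in>Pow (Y \<inter> U). (if A = C then 1 else 0) * mlcoeff f (C \<union> B)) =
        (\<Sum>C\<in>Pow (Y \<inter> U). (if A = C then mlcoeff f (C \<union> B) else 0))"
      by (intro sum.cong) auto
    also have "\<dots> = (if A \<subseteq> U then mlcoeff f (A \<union> B) else 0)"
      using ab assms(2) by simp
    also have "\<dots> = mlcoeff f (A \<union> B)"
      using mlcoeff_zero_outside[OF assms(1), of "A \<union> B"] ab by auto
    finally show "mlcoeff f (A \<union> B) = (\<Sum>C\<in>Pow (Y \<inter> U). (if A = C then 1 else 0) * mlcoeff f (C \<union> B))"
      by simp
  qed (use assms in \<open>auto simp: card_Pow simp del: Pow_Int_eq\<close>)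
  have 2: "rank_le Y (2 ^ card (U - Y)) f"
  proof (rule rank_leI[of "Pow (U - Y)" _ _ _ "\<lambda>C A. mlcoeff f (A \<union> C)" "\<lambda>C B. if B = C then 1 else 0"])
    fix A B :: "'v set"
    assume ab: "finite A" "finite B" "A \<subseteq> Y" "B \<inter> Y = {}"
    have "(\<Sum>C\<in>Pow (U - Y). mlcoeff f (A \<union> C) * (if B = C then 1 else 0)) =
        (\<Sum>C\<in>Pow (U - Y). (if B = C then mlcoeff f (A \<union> C) else 0))"
      by (intro sum.cong) auto
    also have "\<dots> = (if B \<subseteq> U - Y then mlcoeff f (A \<union> B) else 0)"
      using ab assms(2) by (simp add: Pow_def)
    also have "\<dots> = mlcoeff f (A \<union> B)"
      using mlcoeff_zero_outside[OF assms(1), of "A \<union> B"] ab by auto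
    finally show "mlcoeff f (A \<union> B) = (\<Sum>C\<in>Pow (U - Y). mlcoeff f (A \<union> C) * (if B = C then 1 else 0))"
      by simp
  qed (use assms in \<open>auto simp: card_Pow\<close>)
  show ?thesis using 1 2 by (simp add: min_def)
qed

lemma mconst_mult_mconst: "mconst c * mconst d = mconst (c * d)"
  and mconst_add_mconst: "mconst c + mconst d = mconst (c + d)"
  by (simp_all add: mconst_def mult_single single_add)

text \<open>The shift \<open>c\<close> is given to the second summand alone, so it causes no extra
  rank.\<close>

lemma affine_rank_le_add:
  assumes "affine_rank_le Y K f" "affine_rank_le Y L g"
  shows "affine_rank_le Y (K + L) (f + g)"
  unfolding affine_rank_le_def
proof (intro allI)
  fix c d
  have "rank_le Y (K + L) ((mconst d * f + mconst 0) + (mconst d * g + mconst c))"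
    using assms unfolding affine_rank_le_def by (blast intro: rank_le_add)
  then show "rank_le Y (K + L) (mconst d * (f + g) + mconst c)"
    by (simp add: algebra_simps mconst_def)
qed

text \<open>A shift cannot be distributed over a product, so it is paid for by one more rank-one
  term.\<close>

lemma affine_rank_le_mult:
  assumes "affine_rank_le Y K f" "affine_rank_le Y L g" "vars_in U f" "vars_in V g" "U \<inter> V = {}"
  shows "affine_rank_le Y (K * L + 1) (f * g)"
  unfolding affine_rank_le_def
proof (intro allI)
  fix c d
  have "rank_le Y K (mconst 1 * f + mconst 0)" "rank_le Y L (mconst 1 * g + mconst 0)"
    using assms unfolding affine_rank_le_def by blast+
  then have "rank_le Y K f" "rank_le Y L g" by (simp_all add: mconst_def)
  then show "rank_le Y (K * L + 1) (mconst d * (f * g) + mconst c)"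
    using assms(3-) by (intro rank_le_add rank_le_mconst_mult rank_le_mconst rank_le_mult)
qed

lemma affine_rank_le_add_mconst:
  assumes "affine_rank_le Y K f"
  shows "affine_rank_le Y K (f + mconst e)"
  unfolding affine_rank_le_def
proof (intro allI)
  fix c d
  have "rank_le Y K (mconst d * f + mconst (d * e + c))"
    using assms unfolding affine_rank_le_def by blast
  then show "rank_le Y K (mconst d * (f + mconst e) + mconst c)"
    by (simp add: algebra_simps mconst_mult_mconst flip: mconst_add_mconst)
qed

lemma affine_rank_le_mult_mconst:
  assumes "affine_rank_le Y K f"
  shows "affine_rank_le Y K (f * mconst e)"
  unfolding affine_rank_le_def
proof (intro allI)
  fix c d
  have "rank_le Y K (mconst (d * e) * f + mconst c)"
    using assms unfolding affine_rank_le_def by blast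
  then show "rank_le Y K (mconst d * (f * mconst e) + mconst c)"
    by (simp add: algebra_simps flip: mconst_mult_mconst)
qed

lemma affine_rank_le_generic:
  assumes "vars_in U f" "finite U"
  shows "affine_rank_le Y (2 ^ min (card (Y \<inter> U)) (card (U - Y))) f"
  unfolding affine_rank_le_def using assms
  by (intro allI rank_le_generic vars_in_add vars_in_mult) auto

section \<open>Sums over all subsets as unnormalised expectations\<close>

text \<open>Independence of \<open>Y \<inter> U\<close> and \<open>Y \<inter> V\<close> for a
  uniformly random \<open>Y\<close>: such a \<open>Y\<close> is an arbitrary pair of subsets of
  \<open>U\<close> and \<open>V\<close>.\<close>

lemma sum_Pow_disjoint_Un:
  fixes g h :: "'v set \<Rightarrow> 'c::comm_semiring_1"
  assumes "finite U" "finite V" "U \<inter> V = {}"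
  shows "(\<Sum>Y\<in>Pow (U \<union> V). g (Y \<inter> U) * h (Y \<inter> V)) = (\<Sum>Y\<in>Pow U. g Y) * (\<Sum>Y\<in>Pow V. h Y)"
proof -
  have "(\<Sum>Y\<in>Pow U. g Y) * (\<Sum>Y\<in>Pow V. h Y) = (\<Sum>(A, B)\<in>Pow U \<times> Pow V. g A * h B)"
    by (simp add: sum_product sum.cartesian_product)
  also have "\<dots> = (\<Sum>Y\<in>Pow (U \<union> V). g (Y \<inter> U) * h (Y \<inter> V))"
    by (rule sum.reindex_bij_witness[of _ "\<lambda>Y. (Y \<inter> U, Y \<inter> V)" "\<lambda>(A, B). A \<union> B"])
      (use assms in \<open>auto intro!: arg_cong2[where f = "(*)"] arg_cong[where f = g] arg_cong[where f = h]\<close>)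
  finally show ?thesis by simp
qed

text \<open>Each subset of \<open>U\<close> is the trace of \<open>2 ^ (card V - card U)\<close>
  subsets of \<open>V\<close>.\<close>

lemma sum_Pow_restrict:
  fixes g :: "'v set \<Rightarrow> 'c::comm_semiring_1"
  assumes "finite V" "U \<subseteq> V"
  shows "(\<Sum>Y\<in>Pow V. g (Y \<inter> U)) = 2 ^ (card V - card U) * (\<Sum>Y\<in>Pow U. g Y)"
proof -
  have fin: "finite U" using assms finite_subset by blast
  have "(\<Sum>Y\<in>Pow (U \<union> (V - U)). g (Y \<inter> U) * 1) = (\<Sum>Y\<in>Pow U. g Y) * (\<Sum>Y\<in>Pow (V - U). 1)"
    using assms fin by (intro sum_Pow_disjoint_Un) auto
  moreover have "U \<union> (V - U) = V" using assms by auto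
  ultimately show ?thesis
    using assms fin by (simp add: card_Pow card_Diff_subset mult.commute)
qed

text \<open>By Pascal's rule this is the sum of \<open>(n choose k) * g k\<close>, in a recursive
  form that the simplifier evaluates for a concrete \<open>n\<close>.\<close>

fun binomial_sum :: "nat \<Rightarrow> (nat \<Rightarrow> nat) \<Rightarrow> nat" where
  "binomial_sum 0 g = g 0"
| "binomial_sum (Suc n) g = binomial_sum n g + binomial_sum n (g \<circ> Suc)"

lemma sum_Pow_card: "finite U \<Longrightarrow> (\<Sum>Y\<in>Pow U. g (card Y)) = binomial_sum (card U) g"
proof (induction U arbitrary: g rule: finite_induct)
  case (insert x U)
  have "(\<Sum>Y\<in>Pow (insert x U). g (card Y)) =
      (\<Sum>Y\<in>Pow U. g (card Y)) + (\<Sum>Y\<in>insert x ` Pow U. g (card Y))"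
    unfolding Pow_insert using insert by (intro sum.union_disjoint) auto
  also have "(\<Sum>Y\<in>insert x ` Pow U. g (card Y)) = (\<Sum>Y\<in>Pow U. g (card (insert x Y)))"
    using insert by (subst sum.reindex) (auto intro!: inj_onI dest: insert_ident[THEN iffD1, rotated 2])
  also have "\<dots> = (\<Sum>Y\<in>Pow U. (g \<circ> Suc) (card Y))"
  proof (rule sum.cong)
    fix Y assume "Y \<in> Pow U"
    then have "finite Y" "x \<notin> Y" using insert finite_subset by auto
    then show "g (card (insert x Y)) = (g \<circ> Suc) (card Y)" by simp
  qed simp
  finally show ?case using insert by (simp del: o_apply)
qed simp

section \<open>Numerical inequalities behind the rate 7/5\<close>

text \<open>The five sums are 2, 6, 14, 42 and 102. The base \<open>14/5 = 2 * 7/5\<close> combines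
  the number of sets with an average rank of 7/5 per variable; the factor \<open>4/5\<close> leaves
  room for the extra 1 at product gates. For \<open>n = 0\<close> the bound would fail, so formulas
  without variables are treated separately.\<close>

lemma small_average:
  assumes "1 \<le> n" "n \<le> 5"
  shows "real (binomial_sum n (\<lambda>k. 2 ^ min k (n - k))) \<le> 4/5 * (14/5) ^ n"
proof -
  have "n = 1 \<or> n = 2 \<or> n = 3 \<or> n = 4 \<or> n = 5" using assms by linarith
  then show ?thesis by (elim disjE; simp add: eval_nat_numeral)
qed

text \<open>Up to common factors the claim is \<open>(7/5)^a + (7/5)^b \<le> (7/5)^(a+b)\<close>,
  which is false for few variables, for instance for \<open>a = b = 2\<close>.\<close>

lemma average_add_bound:
  fixes S T :: real
  assumes "S \<le> 4/5 * (14/5) ^ a" "T \<le> 4/5 * (14/5) ^ b" "1 \<le> a" "1 \<le> b" "6 \<le> a + b"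
  shows "2 ^ b * S + 2 ^ a * T \<le> 4/5 * (14/5) ^ (a + b)"
proof -
  have key: "(7/5) ^ x + (7/5) ^ y \<le> (7/5 :: real) ^ (x + y)" if "1 \<le> x" "x \<le> y" "6 \<le> x + y" for x y :: nat
  proof -
    \<comment> \<open>Expanding this product gives the inequality. As \<open>x \<le> y\<close> and
      \<open>6 \<le> x + y\<close>, it suffices to check the extreme cases \<open>(1, 5)\<close> and
      \<open>(2, 3)\<close>.\<close>
    have "1 \<le> ((7/5) ^ x - 1) * ((7/5 :: real) ^ y - 1)"
    proof (cases "x = 1")
      case True
      then have "(7/5 :: real) ^ 5 \<le> (7/5) ^ y" using that by (intro power_increasing) auto
      with True show ?thesis by (simp add: eval_nat_numeral)
    next
      case False
      then have "(7/5 :: real) ^ 2 \<le> (7/5) ^ x" "(7/5 :: real) ^ 3 \<le> (7/5) ^ y"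
        using that by (intro power_increasing; simp)+
      then have "((7/5 :: real) ^ 2 - 1) * ((7/5) ^ 3 - 1) \<le> ((7/5) ^ x - 1) * ((7/5) ^ y - 1)"
        by (intro mult_mono) (auto simp: eval_nat_numeral)
      then show ?thesis by (simp add: eval_nat_numeral)
    qed
    then show ?thesis by (simp add: algebra_simps power_add)
  qed
  have k: "(7/5) ^ a + (7/5) ^ b \<le> (7/5 :: real) ^ (a + b)"
    using key[of a b] key[of b a] assms by (cases "a \<le> b") (simp_all add: add.commute)
  have split: "(14/5 :: real) ^ x = 2 ^ x * (7/5) ^ x" for x
    by (simp flip: power_mult_distrib)
  have "2 ^ b * S + 2 ^ a * T \<le> 2 ^ b * (4/5 * (14/5) ^ a) + 2 ^ a * (4/5 * (14/5) ^ b)"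
    using assms by (intro add_mono mult_left_mono) auto
  also have "\<dots> = 4/5 * 2 ^ (a + b) * ((7/5) ^ a + (7/5) ^ b)"
    by (simp add: split power_add algebra_simps)
  also have "\<dots> \<le> 4/5 * 2 ^ (a + b) * (7/5) ^ (a + b)"
    using k by (intro mult_left_mono) auto
  finally show ?thesis by (simp add: split)
qed

text \<open>Squaring \<open>4/5\<close> leaves \<open>4/25\<close> of the budget for the term
  \<open>2 ^ (a + b)\<close>, which fits once \<open>(7/5) ^ (a + b) \<ge> 25/4\<close>. This holds
  from exponent 6 on but not for 5, whence the trivial bound is used up to five variables.\<close>

lemma average_mult_bound:
  fixes S T :: real
  assumes "0 \<le> S" "0 \<le> T" "S \<le> 4/5 * (14/5) ^ a" "T \<le> 4/5 * (14/5) ^ b" "6 \<le> a + b"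
  shows "S * T + 2 ^ (a + b) \<le> 4/5 * (14/5) ^ (a + b)"
proof -
  have "S * T \<le> (4/5 * (14/5) ^ a) * (4/5 * (14/5) ^ b)"
    using assms by (intro mult_mono) auto
  also have "\<dots> = 16/25 * (14/5) ^ (a + b)" by (simp add: power_add)
  finally have 1: "S * T \<le> 16/25 * (14/5) ^ (a + b)" .
  have "(7/5 :: real) ^ 6 \<le> (7/5) ^ (a + b)" using assms by (intro power_increasing) auto
  then have "25/4 \<le> (7/5 :: real) ^ (a + b)" by (simp add: eval_nat_numeral)
  then have "2 ^ (a + b) * (25/4) \<le> 2 ^ (a + b) * (7/5 :: real) ^ (a + b)"
    by (intro mult_left_mono) auto
  then have "2 ^ (a + b) * (25/4) \<le> (14/5 :: real) ^ (a + b)"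
    by (simp flip: power_mult_distrib)
  with 1 show ?thesis by linarith
qed

section \<open>Induction over the read-once formula\<close>

lemma leaf_count_pos_iff: "0 < leaf_count x p \<longleftrightarrow> x \<in> set1_formula p"
  by (induction p) auto

lemma finite_set1_formula [simp]: "finite (set1_formula p)"
  by (induction p) auto

lemma no_vars_imp_mconst:
  "set1_formula p = {} \<Longrightarrow> \<exists>c. poly_of p = mconst c"
  by (induction p) (auto simp: mconst_mult_mconst mconst_add_mconst)

lemma small_average_rank:
  assumes "vars_in U f" "finite U" "1 \<le> card U" "card U \<le> 5"
  shows "\<exists>T. (\<forall>Y. affine_rank_le Y (T (Y \<inter> U)) f) \<and>
     real (\<Sum>Y\<in>Pow U. T Y) \<le> 4/5 * (14/5) ^ card U"
proof (intro exI[of _ "\<lambda>Y. 2 ^ min (card Y) (card U - card Y)"] conjI allI)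
  fix Y
  show "affine_rank_le Y (2 ^ min (card (Y \<inter> U)) (card U - card (Y \<inter> U))) f"
    using affine_rank_le_generic[OF assms(1,2), of Y] assms(2)
    by (simp add: card_Diff_subset_Int Int_commute)
  show "real (\<Sum>Y\<in>Pow U. 2 ^ min (card Y) (card U - card Y)) \<le> 4/5 * (14/5) ^ card U"
    using small_average[OF assms(3,4)]
      sum_Pow_card[OF assms(2), of "\<lambda>k. 2 ^ min k (card U - k)"] by simp
qed

text \<open>The majorant \<open>T\<close> of the rank depends only on the trace of \<open>Y\<close>
  on the variables read, so the majorants of the two children of a gate are independent. A child
  without variables is a constant and is absorbed by the affine rank; a gate with at most five
  variables gets the trivial bound; only larger gates use the inequalities for sums and
  products.\<close>

lemma read_once_average_rank:
  fixes p :: "('v, 'c::comm_ring_1) formula"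
  assumes "\<And>x. leaf_count x p \<le> 1" "set1_formula p \<noteq> {}"
  shows "\<exists>T. (\<forall>Y. affine_rank_le Y (T (Y \<inter> set1_formula p)) (poly_of p)) \<and>
     real (\<Sum>Y\<in>Pow (set1_formula p). T Y) \<le> 4/5 * (14/5) ^ card (set1_formula p)"
  using assms
proof (induction p)
  case (Var v)
  show ?case
    using small_average_rank[OF vars_in_poly_of[of "Var v"]] by simp
next
  case (Const c)
  then show ?case by simp
next
  case (Add p q)
  let ?U = "set1_formula p" and ?V = "set1_formula q"
  have once: "leaf_count x p \<le> 1" "leaf_count x q \<le> 1" "x \<notin> ?U \<inter> ?V" for x
    using Add.prems(1)[of x] leaf_count_pos_iff[of x p] leaf_count_pos_iff[of x q] by auto
  then have disj: "?U \<inter> ?V = {}" by blast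
  consider "?V = {}" | "?U = {}" | "?U \<noteq> {}" "?V \<noteq> {}" "card (?U \<union> ?V) \<le> 5"
    | "?U \<noteq> {}" "?V \<noteq> {}" "6 \<le> card (?U \<union> ?V)" by linarith
  then show ?case
  proof cases
    case 1
    then obtain c where "poly_of q = mconst c" using no_vars_imp_mconst by blast
    moreover obtain T where "\<forall>Y. affine_rank_le Y (T (Y \<inter> ?U)) (poly_of p)"
        "real (\<Sum>Y\<in>Pow ?U. T Y) \<le> 4/5 * (14/5) ^ card ?U"
      using Add.IH(1)[OF once(1)] Add.prems(2) 1 by auto
    ultimately show ?thesis using 1 by (intro exI[of _ T]) (simp add: affine_rank_le_add_mconst)
  next
    case 2
    then obtain c where "poly_of p = mconst c" using no_vars_imp_mconst by blast
    moreover obtain T where "\<forall>Y. affine_rank_le Y (T (Y \<inter> ?V)) (poly_of q)"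
        "real (\<Sum>Y\<in>Pow ?V. T Y) \<le> 4/5 * (14/5) ^ card ?V"
      using Add.IH(2)[OF once(2)] Add.prems(2) 2 by auto
    ultimately show ?thesis using 2
      by (intro exI[of _ T]) (simp add: affine_rank_le_add_mconst add.commute[of "mconst c"])
  next
    case 3
    then show ?thesis
      using small_average_rank[OF vars_in_poly_of[of "Add p q"]] by (auto simp: Suc_le_eq card_gt_0_iff)
  next
    case 4
    then obtain S T where
      S: "\<forall>Y. affine_rank_le Y (S (Y \<inter> ?U)) (poly_of p)"
        "real (\<Sum>Y\<in>Pow ?U. S Y) \<le> 4/5 * (14/5) ^ card ?U" and
      T: "\<forall>Y. affine_rank_le Y (T (Y \<inter> ?V)) (poly_of q)"
        "real (\<Sum>Y\<in>Pow ?V. T Y) \<le> 4/5 * (14/5) ^ card ?V"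
      using Add.IH once by blast
    have card: "card (?U \<union> ?V) = card ?U + card ?V" "1 \<le> card ?U" "1 \<le> card ?V"
      using disj 4 by (auto simp: card_Un_disjoint Suc_le_eq card_gt_0_iff)
    show ?thesis
    proof (intro exI[of _ "\<lambda>Y. S (Y \<inter> ?U) + T (Y \<inter> ?V)"] conjI allI)
      fix Y
      show "affine_rank_le Y (S (Y \<inter> set1_formula (Add p q) \<inter> ?U) + T (Y \<inter> set1_formula (Add p q) \<inter> ?V))
          (poly_of (Add p q))"
        using S T by (auto intro!: affine_rank_le_add simp: Int_assoc Int_absorb1)
      have "(\<Sum>Y\<in>Pow (?U \<union> ?V). S (Y \<inter> ?U) + T (Y \<inter> ?V)) =
          2 ^ card ?V * (\<Sum>Y\<in>Pow ?U. S Y) + 2 ^ card ?U * (\<Sum>Y\<in>Pow ?V. T Y)"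
        using sum_Pow_restrict[of "?U \<union> ?V" ?U S] sum_Pow_restrict[of "?U \<union> ?V" ?V T] card(1)
        by (simp add: sum.distrib)
      then show "real (\<Sum>Y\<in>Pow (set1_formula (Add p q)). S (Y \<inter> ?U) + T (Y \<inter> ?V))
          \<le> 4/5 * (14/5) ^ card (set1_formula (Add p q))"
        using average_add_bound[OF S(2) T(2)] 4(3) card by simp
    qed
  qed
next
  case (Mult p q)
  let ?U = "set1_formula p" and ?V = "set1_formula q"
  have once: "leaf_count x p \<le> 1" "leaf_count x q \<le> 1" "x \<notin> ?U \<inter> ?V" for x
    using Mult.prems(1)[of x] leaf_count_pos_iff[of x p] leaf_count_pos_iff[of x q] by auto
  then have disj: "?U \<inter> ?V = {}" by blast
  consider "?V = {}" | "?U = {}" | "?U \<noteq> {}" "?V \<noteq> {}" "card (?U \<union> ?V) \<le> 5"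
    | "?U \<noteq> {}" "?V \<noteq> {}" "6 \<le> card (?U \<union> ?V)" by linarith
  then show ?case
  proof cases
    case 1
    then obtain c where "poly_of q = mconst c" using no_vars_imp_mconst by blast
    moreover obtain T where "\<forall>Y. affine_rank_le Y (T (Y \<inter> ?U)) (poly_of p)"
        "real (\<Sum>Y\<in>Pow ?U. T Y) \<le> 4/5 * (14/5) ^ card ?U"
      using Mult.IH(1)[OF once(1)] Mult.prems(2) 1 by auto
    ultimately show ?thesis using 1 by (intro exI[of _ T]) (simp add: affine_rank_le_mult_mconst)
  next
    case 2
    then obtain c where "poly_of p = mconst c" using no_vars_imp_mconst by blast
    moreover obtain T where "\<forall>Y. affine_rank_le Y (T (Y \<inter> ?V)) (poly_of q)"
        "real (\<Sum>Y\<in>Pow ?V. T Y) \<le> 4/5 * (14/5) ^ card ?V"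
      using Mult.IH(2)[OF once(2)] Mult.prems(2) 2 by auto
    ultimately show ?thesis using 2
      by (intro exI[of _ T]) (simp add: affine_rank_le_mult_mconst mult.commute[of "mconst c"])
  next
    case 3
    then show ?thesis
      using small_average_rank[OF vars_in_poly_of[of "Mult p q"]] by (auto simp: Suc_le_eq card_gt_0_iff)
  next
    case 4
    then obtain S T where
      S: "\<forall>Y. affine_rank_le Y (S (Y \<inter> ?U)) (poly_of p)"
        "real (\<Sum>Y\<in>Pow ?U. S Y) \<le> 4/5 * (14/5) ^ card ?U" and
      T: "\<forall>Y. affine_rank_le Y (T (Y \<inter> ?V)) (poly_of q)"
        "real (\<Sum>Y\<in>Pow ?V. T Y) \<le> 4/5 * (14/5) ^ card ?V"
      using Mult.IH once by blast
    have card: "card (?U \<union> ?V) = card ?U + card ?V"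
      using disj by (auto simp: card_Un_disjoint)
    \<comment> \<open>Summed over all \<open>Y\<close>, the extra 1 from the shift of a product
      becomes the term \<open>2 ^ (a + b)\<close> in \<open>average_mult_bound\<close>.\<close>
    show ?thesis
    proof (intro exI[of _ "\<lambda>Y. S (Y \<inter> ?U) * T (Y \<inter> ?V) + 1"] conjI allI)
      fix Y
      have "affine_rank_le Y (S (Y \<inter> ?U) * T (Y \<inter> ?V) + 1) (poly_of p * poly_of q)"
        using S T disj by (intro affine_rank_le_mult) (auto simp: vars_in_poly_of)
      then show "affine_rank_le Y (S (Y \<inter> set1_formula (Mult p q) \<inter> ?U) * T (Y \<inter> set1_formula (Mult p q) \<inter> ?V) + 1)
          (poly_of (Mult p q))"
        by (auto simp: Int_assoc Int_absorb1)
      have "(\<Sum>Y\<in>Pow (?U \<union> ?V). S (Y \<inter> ?U) * T (Y \<inter> ?V) + 1) =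
          (\<Sum>Y\<in>Pow ?U. S Y) * (\<Sum>Y\<in>Pow ?V. T Y) + 2 ^ card (?U \<union> ?V)"
        using disj by (simp only: sum.distrib sum_Pow_disjoint_Un finite_set1_formula) (simp add: card_Pow)
      then show "real (\<Sum>Y\<in>Pow (set1_formula (Mult p q)). S (Y \<inter> ?U) * T (Y \<inter> ?V) + 1)
          \<le> 4/5 * (14/5) ^ card (set1_formula (Mult p q))"
        using average_mult_bound[OF of_nat_0_le_iff of_nat_0_le_iff S(2) T(2)] 4(3) card by simp
    qed
  qed
qed

text \<open>A variable of \<open>X\<close> that the formula does not read doubles the number of sets
  without changing the majorant, and \<open>2 \<le> 14/5\<close>.\<close>

lemma read_once_poly_average_rank:
  fixes f :: "('v, 'c::comm_ring_1) mpoly"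
  assumes "read_once_poly X f" "finite X"
  shows "\<exists>T. (\<forall>Y. rank_le Y (T Y) f) \<and> real (\<Sum>Y\<in>Pow X. T Y) \<le> (14/5) ^ card X"
proof -
  obtain p where p: "set1_formula p \<subseteq> X" "\<And>x. leaf_count x p \<le> 1" "poly_of p = f"
    using assms unfolding read_computable_def read_formula_def by blast
  let ?U = "set1_formula p"
  show ?thesis
  proof (cases "?U = {}")
    case True
    then obtain c where "f = mconst c" using no_vars_imp_mconst p by blast
    moreover have "(2::real) ^ card X \<le> (14/5) ^ card X" by (intro power_mono) auto
    ultimately show ?thesis
      using assms(2) by (intro exI[of _ "\<lambda>_. 1"]) (auto simp: rank_le_mconst[unfolded One_nat_def] card_Pow)
  next
    case False
    then obtain T where T: "\<forall>Y. affine_rank_le Y (T (Y \<inter> ?U)) f"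
      "real (\<Sum>Y\<in>Pow ?U. T Y) \<le> 4/5 * (14/5) ^ card ?U"
      using read_once_average_rank[OF p(2)] p(3) by blast
    have "rank_le Y (T (Y \<inter> ?U)) (mconst 1 * f + mconst 0)" for Y
      using T(1) unfolding affine_rank_le_def by blast
    moreover have "real (\<Sum>Y\<in>Pow X. T (Y \<inter> ?U)) \<le> (14/5) ^ card X"
    proof -
      have le: "card ?U \<le> card X" using p(1) assms(2) by (rule card_mono[rotated])
      have "real (\<Sum>Y\<in>Pow X. T (Y \<inter> ?U)) = 2 ^ (card X - card ?U) * real (\<Sum>Y\<in>Pow ?U. T Y)"
        using sum_Pow_restrict[OF assms(2) p(1), of T] by simp
      also have "\<dots> \<le> (14/5) ^ (card X - card ?U) * (14/5) ^ card ?U"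
        using T(2) by (intro mult_mono power_mono order.trans[OF T(2)]) (auto intro: sum_nonneg)
      also have "\<dots> = (14/5) ^ card X" using le by (simp flip: power_add)
      finally show ?thesis .
    qed
    ultimately show ?thesis by (intro exI[of _ "\<lambda>Y. T (Y \<inter> ?U)"]) (simp add: mconst_def)
  qed
qed

section \<open>Nonsingular coefficient matrices\<close>

text \<open>The matrix \<open>F (A \<union> B)\<close> with rows \<open>A \<subseteq> U \<inter> Y\<close> and columns \<open>B \<subseteq> U - Y\<close> has linearly
  independent rows.\<close>

definition rows_indep :: "'v set \<Rightarrow> 'v set \<Rightarrow> ('v set \<Rightarrow> 'c::comm_ring_1) \<Rightarrow> bool" where
  "rows_indep Y U F \<longleftrightarrow> (\<forall>c. (\<forall>B\<in>Pow (U - Y). (\<Sum>A\<in>Pow (U \<inter> Y). c A * F (A \<union> B)) = 0) \<longrightarrow>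
     (\<forall>A\<in>Pow (U \<inter> Y). c A = 0))"

lemma rows_indepI:
  assumes "\<And>c A. (\<And>B. B \<subseteq> U - Y \<Longrightarrow> (\<Sum>A\<in>Pow (U \<inter> Y). c A * F (A \<union> B)) = 0) \<Longrightarrow>
     A \<subseteq> U \<inter> Y \<Longrightarrow> c A = 0"
  shows "rows_indep Y U F"
  unfolding rows_indep_def using assms by blast

lemma rows_indepD:
  assumes "rows_indep Y U F" "\<And>B. B \<subseteq> U - Y \<Longrightarrow> (\<Sum>A\<in>Pow (U \<inter> Y). c A * F (A \<union> B)) = 0"
    "A \<subseteq> U \<inter> Y"
  shows "c A = 0"
  using assms unfolding rows_indep_def by blast

lemma rows_indep_cong:
  assumes "\<And>A. A \<subseteq> U \<Longrightarrow> F A = G A" "rows_indep Y U F"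
  shows "rows_indep Y U G"
proof (rule rows_indepI)
  fix c A
  assume c: "\<And>B. B \<subseteq> U - Y \<Longrightarrow> (\<Sum>A\<in>Pow (U \<inter> Y). c A * G (A \<union> B)) = 0" and A: "A \<subseteq> U \<inter> Y"
  show "c A = 0"
  proof (rule rows_indepD[OF assms(2) _ A])
    fix B assume B: "B \<subseteq> U - Y"
    have "(\<Sum>A\<in>Pow (U \<inter> Y). c A * F (A \<union> B)) = (\<Sum>A\<in>Pow (U \<inter> Y). c A * G (A \<union> B))"
      using B by (intro sum.cong refl arg_cong2[where f = "(*)"] assms(1)) auto
    with c[OF B] show "(\<Sum>A\<in>Pow (U \<inter> Y). c A * F (A \<union> B)) = 0" by simp
  qed
qed

text \<open>The coefficient matrix of a product in disjoint variables is a Kronecker product.\<close>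

lemma rows_indep_mult:
  fixes F G :: "'v set \<Rightarrow> 'c::comm_ring_1"
  assumes F: "rows_indep Y U F" and G: "rows_indep Y V G"
    and fin: "finite U" "finite V" and disj: "U \<inter> V = {}"
  shows "rows_indep Y (U \<union> V) (\<lambda>A. F (A \<inter> U) * G (A \<inter> V))"
proof (rule rows_indepI)
  fix c A
  assume c: "\<And>B. B \<subseteq> U \<union> V - Y \<Longrightarrow>
      (\<Sum>A\<in>Pow ((U \<union> V) \<inter> Y). c A * (F ((A \<union> B) \<inter> U) * G ((A \<union> B) \<inter> V))) = 0"
    and A: "A \<subseteq> (U \<union> V) \<inter> Y"
  \<comment> \<open>For fixed \<open>B2\<close>, these inner sums form, as a function of
    \<open>A1\<close>, a kernel vector for \<open>F\<close>, hence vanish; then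
    \<open>c (A1 \<union> A2)\<close>, as a function of \<open>A2\<close>, is a kernel vector for
    \<open>G\<close>.\<close>
  have z: "(\<Sum>A2\<in>Pow (V \<inter> Y). c (A1 \<union> A2) * G (A2 \<union> B2)) = 0"
    if B2: "B2 \<subseteq> V - Y" and A1: "A1 \<subseteq> U \<inter> Y" for A1 B2
  proof (rule rows_indepD[OF F _ A1, of "\<lambda>A1. \<Sum>A2\<in>Pow (V \<inter> Y). c (A1 \<union> A2) * G (A2 \<union> B2)"])
    fix B1 assume B1: "B1 \<subseteq> U - Y"
    have "(\<Sum>A1\<in>Pow (U \<inter> Y). (\<Sum>A2\<in>Pow (V \<inter> Y). c (A1 \<union> A2) * G (A2 \<union> B2)) * F (A1 \<union> B1)) =
        (\<Sum>(A1, A2)\<in>Pow (U \<inter> Y) \<times> Pow (V \<inter> Y). c (A1 \<union> A2) * (F (A1 \<union> B1) * G (A2 \<union> B2)))"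
      unfolding sum_distrib_right sum.cartesian_product by (intro sum.cong) (auto simp: mult_ac)
    also have "\<dots> = (\<Sum>A\<in>Pow ((U \<union> V) \<inter> Y). c A * (F ((A \<union> (B1 \<union> B2)) \<inter> U) * G ((A \<union> (B1 \<union> B2)) \<inter> V)))"
    proof (rule sum.reindex_bij_witness[of _ "\<lambda>A. (A \<inter> U, A \<inter> V)" "\<lambda>(A1, A2). A1 \<union> A2"], goal_cases)
      case (5 a)
      then obtain A1 A2 where a: "a = (A1, A2)" "A1 \<subseteq> U \<inter> Y" "A2 \<subseteq> V \<inter> Y" by auto
      have "(A1 \<union> A2 \<union> (B1 \<union> B2)) \<inter> U = A1 \<union> B1" "(A1 \<union> A2 \<union> (B1 \<union> B2)) \<inter> V = A2 \<union> B2"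
        using a B1 B2 disj by blast+
      with a show ?case by simp
    qed (use disj in auto)
    also have "\<dots> = 0" using B1 B2 by (intro c) auto
    finally show "(\<Sum>A1\<in>Pow (U \<inter> Y). (\<Sum>A2\<in>Pow (V \<inter> Y). c (A1 \<union> A2) * G (A2 \<union> B2)) * F (A1 \<union> B1)) = 0" .
  qed
  have "c (A \<inter> U \<union> A \<inter> V) = 0"
    using A by (intro rows_indepD[OF G, of "\<lambda>A2. c (A \<inter> U \<union> A2)"] z) auto
  moreover have "A \<inter> U \<union> A \<inter> V = A" using A by auto
  ultimately show "c A = 0" by simp
qed

section \<open>From independent rows to a lower bound on the rank\<close>

text \<open>Gaussian elimination: a homogeneous system with more unknowns than equations has a
  nontrivial solution. Each step uses the last equation to eliminate one unknown.\<close>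

lemma underdetermined_system:
  fixes u :: "nat \<Rightarrow> 'i \<Rightarrow> 'c::field"
  assumes "finite I" "K < card I"
  shows "\<exists>c. (\<exists>i\<in>I. c i \<noteq> 0) \<and> (\<forall>k<K. (\<Sum>i\<in>I. c i * u k i) = 0)"
  using assms
proof (induction K arbitrary: I u)
  case 0
  then have "I \<noteq> {}" by auto
  then show ?case by (intro exI[of _ "\<lambda>_. 1"]) auto
next
  case (Suc K)
  show ?case
  proof (cases "\<forall>i\<in>I. u K i = 0")
    case True
    have "K < card I" using Suc.prems by simp
    with Suc.IH[OF Suc.prems(1), of u] obtain c where
      "\<exists>i\<in>I. c i \<noteq> 0" "\<forall>k<K. (\<Sum>i\<in>I. c i * u k i) = 0" by blast
    with True show ?thesis by (intro exI[of _ c]) (auto simp: less_Suc_eq)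
  next
    case False
    then obtain i0 where i0: "i0 \<in> I" "u K i0 \<noteq> 0" by blast
    define J where "J = I - {i0}"
    \<comment> \<open>The system after eliminating the unknown \<open>i0\<close> with equation
      \<open>K\<close>; the row \<open>v K\<close> becomes zero.\<close>
    define v where "v k i = u k i - u k i0 * u K i / u K i0" for k i
    have J: "finite J" "K < card J" "I = insert i0 J" "i0 \<notin> J"
      using Suc.prems i0 by (auto simp: J_def)
    from Suc.IH[OF J(1,2), of v] obtain c where
      c: "\<exists>i\<in>J. c i \<noteq> 0" "\<And>k. k < K \<Longrightarrow> (\<Sum>i\<in>J. c i * v k i) = 0" by blast
    \<comment> \<open>Back substitution: the value at \<open>i0\<close> is the one forced by
      equation \<open>K\<close>.\<close>
    define d where "d i = (if i = i0 then - (\<Sum>j\<in>J. c j * u K j) / u K i0 else c i)" for i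
    have s: "(\<Sum>i\<in>I. d i * u k i) = (\<Sum>i\<in>J. c i * v k i)" for k
    proof -
      have "(\<Sum>i\<in>J. d i * u k i) = (\<Sum>i\<in>J. c i * u k i)"
        using J by (intro sum.cong) (auto simp: d_def)
      then have "(\<Sum>i\<in>I. d i * u k i) = d i0 * u k i0 + (\<Sum>i\<in>J. c i * u k i)"
        using J by simp
      also have "\<dots> = (\<Sum>i\<in>J. c i * v k i)"
        by (simp add: d_def v_def sum_distrib_right sum_distrib_left sum_divide_distrib right_diff_distrib
            sum_subtractf mult_ac)
      finally show ?thesis .
    qed
    show ?thesis
    proof (intro exI[of _ d] conjI allI impI)
      show "\<exists>i\<in>I. d i \<noteq> 0" using c(1) J by (auto simp: d_def)
      fix k assume "k < Suc K"
      show "(\<Sum>i\<in>I. d i * u k i) = 0"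
      proof (cases "k = K")
        case True
        have "v K i = 0" for i using i0 by (simp add: v_def)
        then show ?thesis using s[of k] True by simp
      qed (use s c(2) \<open>k < Suc K\<close> in auto)
    qed
  qed
qed

text \<open>With fewer rank-one terms than rows, some nontrivial combination of the rows annihilates
  every left factor \<open>u k\<close>, hence the whole matrix.\<close>

lemma rows_indep_rank_le:
  fixes f :: "('v, 'c::field) mpoly"
  assumes "rows_indep Y U (mlcoeff f)" "rank_le Y K f" "finite U"
  shows "2 ^ card (U \<inter> Y) \<le> K"
proof (rule ccontr)
  assume "\<not> 2 ^ card (U \<inter> Y) \<le> K"
  then have K: "K < card (Pow (U \<inter> Y))" using assms(3) by (simp add: card_Pow del: Pow_Int_eq)
  obtain u v where
    f: "\<And>A B. finite A \<Longrightarrow> finite B \<Longrightarrow> A \<subseteq> Y \<Longrightarrow> B \<inter> Y = {} \<Longrightarrow>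
      mlcoeff f (A \<union> B) = (\<Sum>k<K. u k A * v k B)"
    using assms(2) by (elim rank_leE) blast
  obtain c where c: "\<exists>A\<in>Pow (U \<inter> Y). c A \<noteq> 0"
    "\<And>k. k < K \<Longrightarrow> (\<Sum>A\<in>Pow (U \<inter> Y). c A * u k A) = 0"
    using underdetermined_system[OF _ K, of u] assms(3) by blast
  have "c A = 0" if "A \<subseteq> U \<inter> Y" for A
  proof (rule rows_indepD[OF assms(1) _ that])
    fix B assume B: "B \<subseteq> U - Y"
    have "(\<Sum>A\<in>Pow (U \<inter> Y). c A * mlcoeff f (A \<union> B)) =
        (\<Sum>A\<in>Pow (U \<inter> Y). c A * (\<Sum>k<K. u k A * v k B))"
      using B assms(3) by (intro sum.cong refl arg_cong2[where f = "(*)"] f) (auto intro: finite_subset)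
    also have "\<dots> = (\<Sum>A\<in>Pow (U \<inter> Y). \<Sum>k<K. (c A * u k A) * v k B)"
      by (simp add: sum_distrib_left mult.assoc del: Pow_Int_eq)
    also have "\<dots> = (\<Sum>k<K. (\<Sum>A\<in>Pow (U \<inter> Y). c A * u k A) * v k B)"
      by (subst sum.swap) (simp add: sum_distrib_right)
    also have "\<dots> = 0" using c(2) by simp
    finally show "(\<Sum>A\<in>Pow (U \<inter> Y). c A * mlcoeff f (A \<union> B)) = 0" .
  qed
  with c(1) show False by blast
qed

section \<open>Passage to the fraction field\<close>

lemma sum_Fract_one: "(\<Sum>i\<in>I. Fract (f i) 1) = Fract (\<Sum>i\<in>I. f i) 1"
  by (induction I rule: infinite_finite_induct) (auto simp: Zero_fract_def)

lemma common_denominator: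
  fixes c :: "'i \<Rightarrow> 'c::idom fract"
  assumes "finite I"
  shows "\<exists>d e. d \<noteq> 0 \<and> (\<forall>i\<in>I. c i * Fract d 1 = Fract (e i) 1)"
  using assms
proof (induction I rule: finite_induct)
  case empty
  show ?case by (auto intro: exI[of _ 1])
next
  case (insert x I)
  then obtain d e where de: "d \<noteq> 0" "\<forall>i\<in>I. c i * Fract d 1 = Fract (e i) 1" by blast
  obtain a b where ab: "c x = Fract a b" "b \<noteq> 0" by (cases "c x") auto
  define e' where "e' i = (if i = x then a * d else e i * b)" for i
  have "c i * Fract (d * b) 1 = Fract (e' i) 1" if "i \<in> insert x I" for i
  proof (cases "i = x")
    case True
    with ab de show ?thesis by (simp add: e'_def eq_fract mult_ac)
  next
    case False
    have "c i * Fract (d * b) 1 = (c i * Fract d 1) * Fract b 1" by (simp add: mult.assoc)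
    also have "\<dots> = Fract (e i * b) 1" using False that de by simp
    finally show ?thesis using False by (simp add: e'_def)
  qed
  moreover have "d * b \<noteq> 0" using de ab by simp
  ultimately show ?case by blast
qed

text \<open>Clearing denominators turns a dependency over the fraction field into one over the
  domain.\<close>

lemma rows_indep_Fract:
  fixes F :: "'v set \<Rightarrow> 'c::idom"
  assumes "rows_indep Y U F" "finite U"
  shows "rows_indep Y U (\<lambda>A. Fract (F A) 1)"
proof (rule rows_indepI)
  fix c :: "'v set \<Rightarrow> 'c fract" and A
  assume c: "\<And>B. B \<subseteq> U - Y \<Longrightarrow> (\<Sum>A\<in>Pow (U \<inter> Y). c A * Fract (F (A \<union> B)) 1) = 0"
    and A: "A \<subseteq> U \<inter> Y"
  have "finite (Pow (U \<inter> Y))" using assms by simp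
  from common_denominator[OF this, of c] obtain d e where
    de: "d \<noteq> 0" "\<And>A. A \<subseteq> U \<inter> Y \<Longrightarrow> c A * Fract d 1 = Fract (e A) 1" by blast
  have "e A = 0"
  proof (rule rows_indepD[OF assms(1) _ A])
    fix B assume B: "B \<subseteq> U - Y"
    have "Fract (\<Sum>A\<in>Pow (U \<inter> Y). e A * F (A \<union> B)) 1 =
        (\<Sum>A\<in>Pow (U \<inter> Y). (c A * Fract d 1) * Fract (F (A \<union> B)) 1)"
      unfolding sum_Fract_one[symmetric] by (intro sum.cong) (auto simp: de(2))
    also have "\<dots> = Fract d 1 * (\<Sum>A\<in>Pow (U \<inter> Y). c A * Fract (F (A \<union> B)) 1)"
      by (simp add: sum_distrib_left mult_ac del: Pow_Int_eq)
    also have "\<dots> = Fract 0 1" using c[OF B] by (simp add: Zero_fract_def del: Pow_Int_eq)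
    finally show "(\<Sum>A\<in>Pow (U \<inter> Y). e A * F (A \<union> B)) = 0" by (simp add: eq_fract)
  qed
  with de(2)[OF A] have "c A * Fract d 1 = 0" by (simp add: Zero_fract_def)
  moreover have "Fract d 1 \<noteq> 0" using de(1) by (simp add: Zero_fract_def eq_fract)
  ultimately show "c A = 0" by simp
qed

section \<open>Grading by a set of auxiliary variables\<close>

definition deg_in :: "'v set \<Rightarrow> ('v \<Rightarrow>\<^sub>0 nat) \<Rightarrow> nat" where
  "deg_in S m = (\<Sum>v\<in>S. Poly_Mapping.lookup m v)"

definition homog_part :: "'v set \<Rightarrow> nat \<Rightarrow> ('v, 'c::zero) mpoly \<Rightarrow> ('v, 'c) mpoly" where
  "homog_part S k q = Poly_Mapping.mapp (\<lambda>m c. if deg_in S m = k then c else 0) q"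

definition homog :: "'v set \<Rightarrow> nat \<Rightarrow> ('v, 'c::zero) mpoly \<Rightarrow> bool" where
  "homog S k q \<longleftrightarrow> (\<forall>m\<in>Poly_Mapping.keys q. deg_in S m = k)"

lemma deg_in_add: "deg_in S (m + m') = deg_in S m + deg_in S m'"
  by (simp add: deg_in_def lookup_add sum.distrib)

lemma lookup_homog_part:
  "Poly_Mapping.lookup (homog_part S k q) m = (if deg_in S m = k then Poly_Mapping.lookup q m else 0)"
  by (simp add: homog_part_def lookup_mapp when_def not_in_keys_iff_lookup_eq_zero)

lemma homog_part_sum: "homog_part S k (\<Sum>i\<in>I. q i) = (\<Sum>i\<in>I. homog_part S k (q i))"
  by (rule poly_mapping_eqI) (simp add: lookup_homog_part lookup_sum)

lemma homog_part_add: "homog_part S k (p + q) = homog_part S k p + homog_part S k q"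
  by (rule poly_mapping_eqI) (simp add: lookup_homog_part lookup_add)

lemma homog_part_zero [simp]: "homog_part S k 0 = 0"
  by (rule poly_mapping_eqI) (simp add: lookup_homog_part)

text \<open>Multiplication by \<open>a\<close> shifts degrees by \<open>d\<close>. The case
  distinction keeps the truncated subtraction \<open>k - d\<close> honest.\<close>

lemma homog_part_mult:
  fixes a q :: "('v, 'c::comm_ring_1) mpoly"
  assumes "homog S d a"
  shows "homog_part S k (q * a) = (if d \<le> k then homog_part S (k - d) q * a else 0)"
proof (rule poly_mapping_eqI)
  fix m
  let ?g = "\<lambda>m1 m2. Poly_Mapping.lookup q m1 * Poly_Mapping.lookup a m2"
  have keys: "Poly_Mapping.keys (homog_part S (k - d) q) \<subseteq> Poly_Mapping.keys q"
    by (auto simp: in_keys_iff lookup_homog_part split: if_splits)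
  have "Poly_Mapping.lookup (homog_part S (k - d) q * a) m =
      (\<Sum>m1\<in>Poly_Mapping.keys q. \<Sum>m2\<in>Poly_Mapping.keys a.
        (Poly_Mapping.lookup (homog_part S (k - d) q) m1 * Poly_Mapping.lookup a m2 when m1 + m2 = m))"
    unfolding lookup_times_sum using keys
    by (intro sum.mono_neutral_left) (auto simp: not_in_keys_iff_lookup_eq_zero)
  also have "\<dots> = (\<Sum>m1\<in>Poly_Mapping.keys q. \<Sum>m2\<in>Poly_Mapping.keys a.
        if deg_in S m1 = k - d then (?g m1 m2 when m1 + m2 = m) else 0)"
    by (intro sum.cong) (auto simp: lookup_homog_part when_def)
  finally have r: "Poly_Mapping.lookup (homog_part S (k - d) q * a) m = \<dots>" .
  have "Poly_Mapping.lookup (homog_part S k (q * a)) m =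
      (\<Sum>m1\<in>Poly_Mapping.keys q. \<Sum>m2\<in>Poly_Mapping.keys a.
        if deg_in S m = k then (?g m1 m2 when m1 + m2 = m) else 0)"
    by (auto simp: lookup_homog_part lookup_times_sum)
  also have "\<dots> = (\<Sum>m1\<in>Poly_Mapping.keys q. \<Sum>m2\<in>Poly_Mapping.keys a.
        if d \<le> k \<and> deg_in S m1 = k - d then (?g m1 m2 when m1 + m2 = m) else 0)"
    using assms by (intro sum.cong refl) (auto simp: deg_in_add when_def homog_def)
  finally show "Poly_Mapping.lookup (homog_part S k (q * a)) m =
      Poly_Mapping.lookup (if d \<le> k then homog_part S (k - d) q * a else 0) m"
    using r by auto
qed

lemma zero_if_homog_parts_zero: "(\<And>k. homog_part S k q = 0) \<Longrightarrow> q = 0"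
proof (rule poly_mapping_eqI)
  fix m
  assume z: "\<And>k. homog_part S k q = 0"
  have "Poly_Mapping.lookup q m = Poly_Mapping.lookup (homog_part S (deg_in S m) q) m"
    by (simp add: lookup_homog_part)
  then show "Poly_Mapping.lookup q m = Poly_Mapping.lookup 0 m" by (simp add: z)
qed

lemma homog_parts_eventually_zero: "\<exists>N. \<forall>k\<ge>N. homog_part S k q = 0"
proof -
  define N where "N = Suc (\<Sum>m\<in>Poly_Mapping.keys q. deg_in S m)"
  have "homog_part S k q = 0" if "N \<le> k" for k
  proof (rule poly_mapping_eqI)
    fix m
    have "deg_in S m < N" if "m \<in> Poly_Mapping.keys q"
      unfolding N_def using member_le_sum[OF that, of "deg_in S"] by simp
    with \<open>N \<le> k\<close> show "Poly_Mapping.lookup (homog_part S k q) m = Poly_Mapping.lookup 0 m"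
      by (cases "m \<in> Poly_Mapping.keys q") (auto simp: lookup_homog_part not_in_keys_iff_lookup_eq_zero)
  qed
  then show ?thesis by blast
qed

lemma homog_parts_eventually_zero_uniform:
  assumes "finite I"
  shows "\<exists>N. \<forall>i\<in>I. \<forall>k\<ge>N. homog_part S k (q i) = 0"
  using assms
proof (induction I rule: finite_induct)
  case (insert x I)
  then obtain N where "\<forall>i\<in>I. \<forall>k\<ge>N. homog_part S k (q i) = 0" by blast
  moreover obtain M where "\<forall>k\<ge>M. homog_part S k (q x) = 0"
    using homog_parts_eventually_zero by blast
  ultimately show ?case by (intro exI[of _ "max M N"]) auto
qed simp

lemma homog_sum:
  fixes q :: "'i \<Rightarrow> ('v, 'c::comm_monoid_add) mpoly"
  shows "(\<And>i. i \<in> I \<Longrightarrow> homog S k (q i)) \<Longrightarrow> homog S k (\<Sum>i\<in>I. q i)"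
proof (induction I rule: infinite_finite_induct)
  case (insert x I)
  then show ?case using keys_add[of "q x" "sum q I"] by (auto simp: homog_def)
qed (auto simp: homog_def)

lemma homog_add: "homog S k p \<Longrightarrow> homog S k q \<Longrightarrow> homog S k (p + q)"
  using keys_add[of p q] by (auto simp: homog_def)

lemma homog_mult:
  fixes p q :: "('v, 'c::comm_ring_1) mpoly"
  assumes "homog S k p" "homog S l q"
  shows "homog S (k + l) (p * q)"
  unfolding homog_def
proof
  fix m assume "m \<in> Poly_Mapping.keys (p * q)"
  with keys_mult[of p q] obtain a b where
    "m = a + b" "a \<in> Poly_Mapping.keys p" "b \<in> Poly_Mapping.keys q" by blast
  with assms show "deg_in S m = k + l" by (simp add: homog_def deg_in_add)
qed

lemma homog_mvar: "finite S \<Longrightarrow> v \<in> S \<Longrightarrow> homog S 1 (mvar v :: ('v, 'c::comm_ring_1) mpoly)"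
  by (auto simp: homog_def mvar_def deg_in_def lookup_single when_def)

lemma homog_0_if_vars_in:
  assumes "vars_in T q" "S \<inter> T = {}"
  shows "homog S 0 q"
  unfolding homog_def deg_in_def
proof
  fix m assume "m \<in> Poly_Mapping.keys q"
  with assms(1) have "Poly_Mapping.keys m \<subseteq> T" by (simp add: vars_in_def)
  with assms(2) have "v \<notin> Poly_Mapping.keys m" if "v \<in> S" for v
    using that by blast
  then show "(\<Sum>v\<in>S. Poly_Mapping.lookup m v) = 0"
    by (intro sum.neutral) (simp add: not_in_keys_iff_lookup_eq_zero)
qed

section \<open>Kernel vectors of a matrix with parts of degree 0 and 1\<close>

text \<open>Components of equal degree are compared in the kernel equation: \<open>F0\<close>
  preserves degrees and \<open>F1\<close> raises them by one, so in degree 0 only \<open>F0\<close>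
  is seen.\<close>

lemma graded_kernel:
  fixes F0 F1 :: "'x set \<Rightarrow> ('v, 'c::comm_ring_1) mpoly"
  assumes "\<And>A. A \<subseteq> U \<Longrightarrow> homog S 0 (F0 A)" "\<And>A. A \<subseteq> U \<Longrightarrow> homog S 1 (F1 A)"
    and "B \<subseteq> U - Y" "(\<Sum>A\<in>Pow (U \<inter> Y). c A * (F0 (A \<union> B) + F1 (A \<union> B))) = 0"
  shows "(\<Sum>A\<in>Pow (U \<inter> Y). homog_part S 0 (c A) * F0 (A \<union> B)) = 0"
    and "(\<Sum>A\<in>Pow (U \<inter> Y). homog_part S (Suc k) (c A) * F0 (A \<union> B)) +
      (\<Sum>A\<in>Pow (U \<inter> Y). homog_part S k (c A) * F1 (A \<union> B)) = 0"
proof -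
  have h: "homog S 0 (F0 (A \<union> B))" "homog S 1 (F1 (A \<union> B))" if "A \<in> Pow (U \<inter> Y)" for A
  proof -
    have "A \<union> B \<subseteq> U" using that assms(3) by auto
    then show "homog S 0 (F0 (A \<union> B))" "homog S 1 (F1 (A \<union> B))" by (fact assms(1), fact assms(2))
  qed
  have e: "(\<Sum>A\<in>Pow (U \<inter> Y). homog_part S k (c A * F0 (A \<union> B)) + homog_part S k (c A * F1 (A \<union> B))) = 0" for k
    using arg_cong[OF assms(4), of "homog_part S k"]
    by (simp add: homog_part_sum homog_part_add distrib_left del: Pow_Int_eq)
  have "(\<Sum>A\<in>Pow (U \<inter> Y). homog_part S 0 (c A) * F0 (A \<union> B)) =
      (\<Sum>A\<in>Pow (U \<inter> Y). homog_part S 0 (c A * F0 (A \<union> B)) + homog_part S 0 (c A * F1 (A \<union> B)))"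
    using h by (intro sum.cong refl) (simp add: homog_part_mult[of S 0] homog_part_mult[of S 1])
  with e show "(\<Sum>A\<in>Pow (U \<inter> Y). homog_part S 0 (c A) * F0 (A \<union> B)) = 0" by (simp only:)
  have "(\<Sum>A\<in>Pow (U \<inter> Y). homog_part S (Suc k) (c A) * F0 (A \<union> B) + homog_part S k (c A) * F1 (A \<union> B)) =
      (\<Sum>A\<in>Pow (U \<inter> Y). homog_part S (Suc k) (c A * F0 (A \<union> B)) + homog_part S (Suc k) (c A * F1 (A \<union> B)))"
    using h by (intro sum.cong refl) (simp add: homog_part_mult[of S 0] homog_part_mult[of S 1])
  with e show "(\<Sum>A\<in>Pow (U \<inter> Y). homog_part S (Suc k) (c A) * F0 (A \<union> B)) +
      (\<Sum>A\<in>Pow (U \<inter> Y). homog_part S k (c A) * F1 (A \<union> B)) = 0" by (simp only: sum.distrib)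
qed

text \<open>The component of lowest degree of a kernel vector is killed by the degree 0 part of the
  matrix, the component of highest degree by its degree 1 part.\<close>

lemma rows_indep_add_homog_1:
  fixes F0 F1 :: "'x set \<Rightarrow> ('v, 'c::comm_ring_1) mpoly"
  assumes h: "\<And>A. A \<subseteq> U \<Longrightarrow> homog S 0 (F0 A)" "\<And>A. A \<subseteq> U \<Longrightarrow> homog S 1 (F1 A)"
    and ind: "rows_indep Y U F0"
  shows "rows_indep Y U (\<lambda>A. F0 A + F1 A)"
proof (rule rows_indepI)
  fix c A
  assume c: "\<And>B. B \<subseteq> U - Y \<Longrightarrow> (\<Sum>A\<in>Pow (U \<inter> Y). c A * (F0 (A \<union> B) + F1 (A \<union> B))) = 0"
    and A: "A \<subseteq> U \<inter> Y"
  \<comment> \<open>Upward induction: once the components of degree \<open>k\<close> vanish, the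
    equation in degree \<open>Suc k\<close> involves \<open>F0\<close> only.\<close>
  have z: "homog_part S k (c A) = 0" if "A \<subseteq> U \<inter> Y" for k A
    using that
  proof (induction k arbitrary: A)
    case 0
    show ?case
      by (rule rows_indepD[OF ind _ 0]) (rule graded_kernel(1)[OF h _ c], simp_all)
  next
    case (Suc k)
    show ?case
    proof (rule rows_indepD[OF ind _ Suc.prems])
      fix B assume B: "B \<subseteq> U - Y"
      have "(\<Sum>A\<in>Pow (U \<inter> Y). homog_part S k (c A) * F1 (A \<union> B)) = 0"
        using Suc.IH by (intro sum.neutral) auto
      with graded_kernel(2)[OF h B c[OF B], of k]
      show "(\<Sum>A\<in>Pow (U \<inter> Y). homog_part S (Suc k) (c A) * F0 (A \<union> B)) = 0" by (simp del: Pow_Int_eq)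
    qed
  qed
  show "c A = 0" by (rule zero_if_homog_parts_zero) (rule z[OF A])
qed

text \<open>Downward induction on the degree. As there are finitely many rows, a common
  \<open>N\<close> exists from which on all components vanish; if those of degree
  \<open>Suc k\<close> vanish, the equation in that degree involves only \<open>F1\<close> and the
  components of degree \<open>k\<close>.\<close>

lemma rows_indep_add_homog_0:
  fixes F0 F1 :: "'x set \<Rightarrow> ('v, 'c::comm_ring_1) mpoly"
  assumes h: "\<And>A. A \<subseteq> U \<Longrightarrow> homog S 0 (F0 A)" "\<And>A. A \<subseteq> U \<Longrightarrow> homog S 1 (F1 A)"
    and ind: "rows_indep Y U F1" and fin: "finite U"
  shows "rows_indep Y U (\<lambda>A. F0 A + F1 A)"
proof (rule rows_indepI)
  fix c A
  assume c: "\<And>B. B \<subseteq> U - Y \<Longrightarrow> (\<Sum>A\<in>Pow (U \<inter> Y). c A * (F0 (A \<union> B) + F1 (A \<union> B))) = 0"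
    and A: "A \<subseteq> U \<inter> Y"
  have "finite (Pow (U \<inter> Y))" using fin by simp
  from homog_parts_eventually_zero_uniform[OF this, of S c]
  obtain N where N: "\<And>A k. A \<subseteq> U \<inter> Y \<Longrightarrow> N \<le> k \<Longrightarrow> homog_part S k (c A) = 0"
    by blast
  have z: "\<forall>A\<in>Pow (U \<inter> Y). homog_part S k (c A) = 0" if "k \<le> N" for k
    using that
  proof (induction rule: inc_induct)
    case base
    then show ?case using N by auto
  next
    case (step k)
    show ?case
    proof
      fix A assume A: "A \<in> Pow (U \<inter> Y)"
      show "homog_part S k (c A) = 0"
      proof (rule rows_indepD[OF ind])
        fix B assume B: "B \<subseteq> U - Y"
        have "(\<Sum>A\<in>Pow (U \<inter> Y). homog_part S (Suc k) (c A) * F0 (A \<union> B)) = 0"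
          using step.IH by (intro sum.neutral) auto
        with graded_kernel(2)[OF h B c[OF B], of k]
        show "(\<Sum>A\<in>Pow (U \<inter> Y). homog_part S k (c A) * F1 (A \<union> B)) = 0" by (simp del: Pow_Int_eq)
      qed (use A in auto)
    qed
  qed
  have "homog_part S k (c A) = 0" for k
    using z[of k] N[OF A, of k] A by (cases "k \<le> N") auto
  then show "c A = 0" by (rule zero_if_homog_parts_zero)
qed

lemma rows_indep_mult_left:
  fixes F :: "'x set \<Rightarrow> 'c::idom"
  assumes "rows_indep Y U F" "w \<noteq> 0"
  shows "rows_indep Y U (\<lambda>A. w * F A)"
proof (rule rows_indepI)
  fix c A
  assume c: "\<And>B. B \<subseteq> U - Y \<Longrightarrow> (\<Sum>A\<in>Pow (U \<inter> Y). c A * (w * F (A \<union> B))) = 0"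
    and A: "A \<subseteq> U \<inter> Y"
  show "c A = 0"
  proof (rule rows_indepD[OF assms(1) _ A])
    fix B assume B: "B \<subseteq> U - Y"
    have "w * (\<Sum>A\<in>Pow (U \<inter> Y). c A * F (A \<union> B)) = 0"
      using c[OF B] by (simp add: sum_distrib_left mult_ac del: Pow_Int_eq)
    with assms(2) show "(\<Sum>A\<in>Pow (U \<inter> Y). c A * F (A \<union> B)) = 0" by simp
  qed
qed

section \<open>Full rank of the Raz--Yehudayoff polynomials\<close>

definition ry_splits :: "nat \<Rightarrow> nat \<Rightarrow> nat set" where
  "ry_splits i j = {l. i < l \<and> l < j - 1 \<and> even (l - i + 1) \<and> even (j - l)}"

lemma finite_ry_splits [simp]: "finite (ry_splits i j)"
  by (rule finite_subset[of _ "{..j}"]) (auto simp: ry_splits_def)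

lemma ry_empty: "j < i \<Longrightarrow> ry i j = 1"
  by (simp add: ry.simps)

lemma ry_rec:
  "i \<le> j \<Longrightarrow> ry i j = (1 + mvar i * mvar j) * ry (i + 1) (j - 1)
     + (\<Sum>l\<in>ry_splits i j. mconst (wcoeff i l j) * (ry i l * ry (l + 1) j))"
  unfolding ry_splits_def by (subst ry.simps) (simp add: mult.assoc)

lemma vars_in_ry: "vars_in {i..j} (ry i j :: 'a::field polyX)"
proof (induction "Suc j - i" arbitrary: i j rule: less_induct)
  case less
  show ?case
  proof (cases "i \<le> j")
    case True
    have 1: "vars_in {i..j} (ry (i + 1) (j - 1) :: 'a polyX)"
      by (rule vars_in_mono[OF less]) (use True in auto)
    have 2: "vars_in {i..j} (ry i l :: 'a polyX)" "vars_in {i..j} (ry (l + 1) j :: 'a polyX)"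
      if "l \<in> ry_splits i j" for l
    proof -
      show "vars_in {i..j} (ry i l :: 'a polyX)"
        by (rule vars_in_mono[OF less]) (use that in \<open>auto simp: ry_splits_def\<close>)
      show "vars_in {i..j} (ry (l + 1) j :: 'a polyX)"
        by (rule vars_in_mono[OF less]) (use that in \<open>auto simp: ry_splits_def\<close>)
    qed
    show ?thesis
      unfolding ry_rec[OF True]
      by (intro vars_in_add vars_in_mult vars_in_sum vars_in_one vars_in_mconst vars_in_mvar 1 2)
        (use True in auto)
  qed (simp add: ry_empty)
qed

section \<open>Splitting a balanced interval\<close>

text \<open>A discrete intermediate value argument: if both endpoints lie on the same side, the
  discrepancy of \<open>Y\<close> on initial segments has opposite signs at \<open>i\<close> and at
  \<open>j - 1\<close>, so it vanishes in between.\<close>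

lemma balanced_split:
  fixes Y :: "nat set"
  assumes "i < j" "2 * card ({i..j} \<inter> Y) = Suc j - i" "i \<in> Y \<longleftrightarrow> j \<in> Y"
  obtains l where "l \<in> ry_splits i j" "2 * card ({i..l} \<inter> Y) = Suc l - i"
    "2 * card ({l + 1..j} \<inter> Y) = j - l"
proof -
  \<comment> \<open>The number of elements of \<open>Y\<close> in \<open>{i..l}\<close> minus the
    number of the other elements. The sign \<open>s\<close> makes \<open>s * h\<close> run from -1
    at \<open>i\<close> to 1 at \<open>j - 1\<close>.\<close>
  define h where "h l = 2 * int (card ({i..l} \<inter> Y)) - (int l - int i + 1)" for l
  define s :: int where "s = (if i \<in> Y then -1 else 1)"
  have step: "h (Suc l) = h l + (if Suc l \<in> Y then 1 else -1)" if "i \<le> l" for l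
  proof -
    have "{i..Suc l} \<inter> Y = (if Suc l \<in> Y then insert (Suc l) ({i..l} \<inter> Y) else {i..l} \<inter> Y)"
      using that by (auto simp: le_Suc_eq)
    then show ?thesis by (simp add: h_def)
  qed
  have "h i = - s" by (auto simp: h_def s_def)
  moreover have hj: "h j = 0" using assms(1,2) by (simp add: h_def)
  moreover have "h (j - 1) = s"
  proof -
    have "i \<le> j - 1" "Suc (j - 1) = j" using assms(1) by auto
    with step[of "j - 1"] assms(3) hj \<open>h i = - s\<close> show ?thesis by (auto simp: s_def)
  qed
  moreover have ss: "s * s = 1" by (auto simp: s_def)
  ultimately have "\<exists>l. i \<le> l \<and> l \<le> j - 1 \<and> s * h l = 0"
    using assms(1) step
    by (intro nat_intermed_int_val) (auto simp: algebra_simps s_def)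
  then obtain l where l: "i \<le> l" "l \<le> j - 1" "h l = 0" by (auto simp: s_def split: if_splits)
  have "l \<noteq> i" "l \<noteq> j - 1"
    using l \<open>h i = - s\<close> \<open>h (j - 1) = s\<close> by (auto simp: s_def split: if_splits)
  with l have lt: "i < l" "l < j - 1" by auto
  have left: "2 * card ({i..l} \<inter> Y) = Suc l - i"
    using l lt unfolding h_def by linarith
  have "{i..j} \<inter> Y = ({i..l} \<inter> Y) \<union> ({l + 1..j} \<inter> Y)" using lt by auto
  then have "card ({i..j} \<inter> Y) = card ({i..l} \<inter> Y) + card ({l + 1..j} \<inter> Y)"
    by (simp only:) (rule card_Un_disjoint, auto)
  then have right: "2 * card ({l + 1..j} \<inter> Y) = j - l"
    using left assms(2) lt by linarith
  \<comment> \<open>A balanced interval has even length, so the zero of \<open>h\<close> is an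
    admissible splitting point.\<close>
  have "even (l - i + 1)" using left lt by (metis Suc_diff_le dvd_triv_left less_imp_le_nat Suc_eq_plus1)
  moreover have "even (j - l)" using right by (metis dvd_triv_left)
  ultimately show ?thesis using that[of l] left right lt by (simp add: ry_splits_def)
qed

text \<open>The squarefree coefficients of the factor \<open>1 + mvar i * mvar j\<close>, over any
  ring so as to serve both over the polynomials in the auxiliary variables and over their
  fractions.\<close>

definition pair_coeff :: "nat \<Rightarrow> nat \<Rightarrow> nat set \<Rightarrow> 'c::comm_ring_1" where
  "pair_coeff i j A = (if A = {} \<or> A = {i, j} then 1 else 0)"

lemma mlcoeff_pair:
  "i \<noteq> j \<Longrightarrow> finite A \<Longrightarrow> mlcoeff (1 + mvar i * mvar j :: (nat, 'c::comm_ring_1) mpoly) A = pair_coeff i j A"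
  by (auto simp: pair_coeff_def mlcoeff_add mlcoeff_one mlcoeff_mvar_mult_mvar)

text \<open>With rows \<open>{}\<close>, \<open>{a}\<close> and columns \<open>{}\<close>,
  \<open>{b}\<close> the matrix is the identity. The names \<open>a\<close> and \<open>b\<close>
  cover both orders of \<open>i\<close> and \<open>j\<close>.\<close>

lemma rows_indep_pair_aux:
  assumes "a \<in> Y" "b \<notin> Y" "{i, j} = {a, b}"
  shows "rows_indep Y {i, j} (pair_coeff i j :: _ \<Rightarrow> 'c::comm_ring_1)"
  unfolding assms(3)
proof (rule rows_indepI)
  fix c :: "nat set \<Rightarrow> 'c" and A
  assume c: "\<And>B. B \<subseteq> {a, b} - Y \<Longrightarrow> (\<Sum>A\<in>Pow ({a, b} \<inter> Y). c A * pair_coeff i j (A \<union> B)) = 0"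
    and A: "A \<subseteq> {a, b} \<inter> Y"
  have s: "{a, b} \<inter> Y = {a}" "a \<noteq> b" using assms by auto
  have P: "Pow {a} = {{}, {a}}" by auto
  have p: "pair_coeff i j {} = (1::'c)" "pair_coeff i j {a} = (0::'c)"
    "pair_coeff i j {b} = (0::'c)" "pair_coeff i j {a, b} = (1::'c)"
    using assms(3) s(2) by (auto simp: pair_coeff_def doubleton_eq_iff)
  have "c {} = 0" using c[of "{}"] p unfolding s P by (simp add: insert_commute)
  moreover have "c {a} = 0" using c[of "{b}"] assms(2) p unfolding s P by (simp add: insert_commute)
  moreover have "A = {} \<or> A = {a}" using A s by auto
  ultimately show "c A = 0" by auto
qed

lemma rows_indep_pair:
  assumes "i \<in> Y \<longleftrightarrow> j \<notin> Y"
  shows "rows_indep Y {i, j} (pair_coeff i j :: _ \<Rightarrow> 'c::comm_ring_1)"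
  using rows_indep_pair_aux[of i Y j i j] rows_indep_pair_aux[of j Y i i j, OF _ _ insert_commute] assms
  by (cases "i \<in> Y") auto

lemma mvar_nonzero: "mvar v \<noteq> (0 :: ('v, 'c::comm_ring_1) mpoly)"
  unfolding mvar_def by (metis lookup_single_eq lookup_zero zero_neq_one)

section \<open>Induction on the length of the interval\<close>

text \<open>Contains the auxiliary variables in the coefficients of \<open>ry i j\<close>. The
  variables \<open>W i l j\<close> of the outermost recursion step belong to no proper subinterval,
  so they can serve for the grading.\<close>

definition inner_wvars :: "nat \<Rightarrow> nat \<Rightarrow> wvar set" where
  "inner_wvars i j = {W i' l j' |i' l j'. i \<le> i' \<and> j' \<le> j}"

text \<open>\<open>G\<close> lifts the coefficients from fractions to polynomials in the auxiliary
  variables, where a grading is available. One lift serves all balanced \<open>Y\<close>.\<close>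

definition ry_coeff_spec :: "nat \<Rightarrow> nat \<Rightarrow> (nat set \<Rightarrow> (wvar, 'a::field) mpoly) \<Rightarrow> bool" where
  "ry_coeff_spec i j G \<longleftrightarrow>
     (\<forall>A\<subseteq>{i..j}. mlcoeff (ry i j) A = Fract (G A) 1 \<and> vars_in (inner_wvars i j) (G A)) \<and>
     (\<forall>Y. 2 * card ({i..j} \<inter> Y) = Suc j - i \<longrightarrow> rows_indep Y {i..j} G)"

text \<open>The recursion gives the lift \<open>H\<close>, the sum of \<open>M\<close> and all
  \<open>W i l j\<close> times \<open>P l\<close>, where \<open>M\<close> and \<open>P l\<close> are
  Kronecker products of matrices of shorter intervals. One of these is nonsingular by induction, and
  a grading that isolates it transfers this to \<open>H\<close>.\<close>

lemma ry_coeff_spec_exists: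
  "even (Suc j - i) \<Longrightarrow> \<exists>G :: nat set \<Rightarrow> (wvar, 'a::field) mpoly. ry_coeff_spec i j G"
proof (induction "Suc j - i" arbitrary: i j rule: less_induct)
  case less
  show ?case
  proof (cases "i \<le> j")
    case False
    \<comment> \<open>On the empty interval the matrix has one entry, namely 1.\<close>
    have "ry_coeff_spec i j (\<lambda>_. 1 :: (wvar, 'a) mpoly)"
      using False by (auto simp: ry_coeff_spec_def ry_empty mlcoeff_one One_fract_def intro!: rows_indepI
        elim!: allE[of _ "{}"])
    then show ?thesis by blast
  next
    case True
    with less.prems have ij: "i < j" by (cases "i = j") auto
    define G :: "nat \<Rightarrow> nat \<Rightarrow> nat set \<Rightarrow> (wvar, 'a) mpoly"
      where "G i' j' = (SOME G. ry_coeff_spec i' j' G)" for i' j'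
    have G: "ry_coeff_spec i' j' (G i' j')" if "Suc j' - i' < Suc j - i" "even (Suc j' - i')" for i' j'
      unfolding G_def using less.hyps[OF that] by (rule someI_ex)
    define L where "L = ry_splits i j"
    have L: "i < l" "l < j - 1" "even (Suc l - i)" "even (j - l)" if "l \<in> L" for l
      using that by (auto simp: L_def ry_splits_def Suc_diff_le)
    have mid: "ry_coeff_spec (i + 1) (j - 1) (G (i + 1) (j - 1))"
      using less.prems ij by (intro G) (auto simp: Suc_diff_le)
    have left: "ry_coeff_spec i l (G i l)" if "l \<in> L" for l
      using L[OF that] by (intro G) auto
    have right: "ry_coeff_spec (l + 1) j (G (l + 1) j)" if "l \<in> L" for l
      using L[OF that] by (intro G) auto
    define M where "M A = pair_coeff i j (A \<inter> {i, j}) * G (i + 1) (j - 1) (A \<inter> {i + 1..j - 1})" for A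
    define P where "P l A = G i l (A \<inter> {i..l}) * G (l + 1) j (A \<inter> {l + 1..j})" for l A
    have U: "{i..j} = {i, j} \<union> {i + 1..j - 1}" "{i, j} \<inter> {i + 1..j - 1} = {}" using ij by auto
    have UL: "{i..j} = {i..l} \<union> {l + 1..j}" "{i..l} \<inter> {l + 1..j} = {}" if "l \<in> L" for l
      using L[OF that] by auto
    have vM: "vars_in (inner_wvars (i + 1) (j - 1)) (M A)" for A
      using mid unfolding M_def ry_coeff_spec_def pair_coeff_def by (intro vars_in_mult) auto
    have vP: "vars_in (inner_wvars i l \<union> inner_wvars (l + 1) j) (P l A)" if "l \<in> L" for l A
      using left[OF that] right[OF that] unfolding P_def ry_coeff_spec_def
      by (intro vars_in_mult) (auto intro: vars_in_mono)
    define H where "H A = M A + (\<Sum>l\<in>L. mvar (W i l j) * P l A)" for A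
    have "mlcoeff (ry i j) A = Fract (H A) 1" if A: "A \<subseteq> {i..j}" for A
    proof -
      have fin: "finite A" using A finite_subset by blast
      have m: "mlcoeff ((1 + mvar i * mvar j) * ry (i + 1) (j - 1)) A = Fract (M A) 1"
      proof -
        have "mlcoeff ((1 + mvar i * mvar j) * ry (i + 1) (j - 1) :: 'a polyX) A =
            mlcoeff (1 + mvar i * mvar j :: 'a polyX) (A \<inter> {i, j}) * mlcoeff (ry (i + 1) (j - 1) :: 'a polyX) (A \<inter> {i + 1..j - 1})"
          using A U fin
          by (intro mlcoeff_mult vars_in_add vars_in_mult vars_in_mvar vars_in_ry) auto
        also have "\<dots> = pair_coeff i j (A \<inter> {i, j}) * Fract (G (i + 1) (j - 1) (A \<inter> {i + 1..j - 1})) 1"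
          using mid fin ij by (subst mlcoeff_pair) (auto simp: ry_coeff_spec_def)
        also have "\<dots> = Fract (M A) 1"
          by (simp add: M_def pair_coeff_def Zero_fract_def)
        finally show ?thesis .
      qed
      have p: "mlcoeff (mconst (wcoeff i l j) * (ry i l * ry (l + 1) j)) A = Fract (mvar (W i l j) * P l A) 1"
        if l: "l \<in> L" for l
      proof -
        have "mlcoeff (ry i l * ry (l + 1) j :: 'a polyX) A =
            mlcoeff (ry i l :: 'a polyX) (A \<inter> {i..l}) * mlcoeff (ry (l + 1) j :: 'a polyX) (A \<inter> {l + 1..j})"
          using A UL[OF l] fin by (intro mlcoeff_mult vars_in_ry) auto
        also have "\<dots> = Fract (P l A) 1"
          using left[OF l] right[OF l] by (simp add: ry_coeff_spec_def P_def)
        finally show ?thesis by (simp add: mlcoeff_mconst_mult wcoeff_def)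
      qed
      have "mlcoeff (ry i j :: 'a polyX) A = Fract (M A) 1 + (\<Sum>l\<in>L. Fract (mvar (W i l j) * P l A) 1)"
        unfolding ry_rec[OF True] mlcoeff_add mlcoeff_sum L_def[symmetric] m
        by (intro arg_cong2[where f = "(+)"] sum.cong refl p)
      then show ?thesis by (simp add: sum_Fract_one H_def)
    qed
    moreover have "vars_in (inner_wvars i j) (H A)" for A
      unfolding H_def using ij
      by (intro vars_in_add vars_in_sum vars_in_mult vars_in_mono[OF vM] vars_in_mono[OF vP] vars_in_mvar)
        (auto simp: inner_wvars_def dest: L)
    moreover have "rows_indep Y {i..j} H" if bal: "2 * card ({i..j} \<inter> Y) = Suc j - i" for Y
    proof (cases "i \<in> Y \<longleftrightarrow> j \<in> Y")
      case True
      from balanced_split[OF ij bal True] obtain k where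
        k: "k \<in> L" "2 * card ({i..k} \<inter> Y) = Suc k - i" "2 * card ({k + 1..j} \<inter> Y) = j - k"
        unfolding L_def by blast
      \<comment> \<open>Grading by this single variable isolates the term of the balanced split
        \<open>k\<close>; \<open>M\<close> and all other splits have degree 0.\<close>
      let ?S = "{W i k j}"
      let ?F0 = "\<lambda>A. M A + (\<Sum>l\<in>L - {k}. mvar (W i l j) * P l A)"
      have P0: "homog ?S 0 (P l A)" if "l \<in> L" for l A
        using L[OF that] by (intro homog_0_if_vars_in[OF vP[OF that]]) (auto simp: inner_wvars_def)
      have "rows_indep Y {i..j} (\<lambda>A. ?F0 A + mvar (W i k j) * P k A)"
      proof (rule rows_indep_add_homog_0[of _ ?S])
        show "homog ?S 0 (?F0 A)" for A
        proof (intro homog_add homog_sum)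
          show "homog ?S 0 (M A)"
            using ij by (intro homog_0_if_vars_in[OF vM]) (auto simp: inner_wvars_def)
          fix l assume l: "l \<in> L - {k}"
          have "homog ?S 0 (mvar (W i l j) :: (wvar, 'a) mpoly)"
            using l by (intro homog_0_if_vars_in[of "{W i l j}"] vars_in_mvar) auto
          then show "homog ?S 0 (mvar (W i l j) * P l A)"
            using homog_mult[of ?S 0 _ 0 "P l A"] P0[of l A] l by auto
        qed
        show "homog ?S 1 (mvar (W i k j) * P k A)" for A
          using homog_mult[OF homog_mvar[of ?S "W i k j"] P0[OF k(1), of A]] by simp
        have "rows_indep Y ({i..k} \<union> {k + 1..j}) (P k)"
          unfolding P_def using left[OF k(1)] right[OF k(1)] k UL[OF k(1)]
          by (intro rows_indep_mult) (auto simp: ry_coeff_spec_def)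
        then have "rows_indep Y {i..j} (P k)" using UL(1)[OF k(1)] by simp
        then show "rows_indep Y {i..j} (\<lambda>A. mvar (W i k j) * P k A)"
          by (rule rows_indep_mult_left) (rule mvar_nonzero)
      qed simp
      moreover have "(\<lambda>A. ?F0 A + mvar (W i k j) * P k A) = H"
      proof
        fix A
        have "(\<Sum>l\<in>L. mvar (W i l j) * P l A) = mvar (W i k j) * P k A + (\<Sum>l\<in>L - {k}. mvar (W i l j) * P l A)"
          by (rule sum.remove[OF _ k(1)]) (simp add: L_def)
        then show "?F0 A + mvar (W i k j) * P k A = H A" unfolding H_def by (simp only: add_ac)
      qed
      ultimately show ?thesis by simp
    next
      case False
      \<comment> \<open>Grading by all splitting variables at once isolates \<open>M\<close> in
        degree 0; every split has degree 1.\<close>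
      let ?S = "(\<lambda>l. W i l j) ` L"
      show ?thesis
        unfolding H_def
      proof (rule rows_indep_add_homog_1[of _ ?S])
        show "homog ?S 0 (M A)" for A
          using ij by (intro homog_0_if_vars_in[OF vM]) (auto simp: inner_wvars_def)
        have P0: "homog ?S 0 (P l A)" if "l \<in> L" for l A
          using L[OF that] by (intro homog_0_if_vars_in[OF vP[OF that]]) (auto simp: inner_wvars_def)
        show "homog ?S 1 (\<Sum>l\<in>L. mvar (W i l j) * P l A)" for A
        proof (rule homog_sum)
          fix l assume l: "l \<in> L"
          show "homog ?S 1 (mvar (W i l j) * P l A)"
            using homog_mult[OF homog_mvar[of ?S "W i l j"] P0[OF l, of A]] l by (simp add: L_def)
        qed
        \<comment> \<open>Exactly one endpoint lies in \<open>Y\<close>, so the inner interval is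
          balanced again.\<close>
        have "card ({i..j} \<inter> Y) = card ({i, j} \<inter> Y) + card ({i + 1..j - 1} \<inter> Y)"
          using U(2) unfolding U(1) Int_Un_distrib2 by (intro card_Un_disjoint) auto
        moreover have "{i, j} \<inter> Y = (if i \<in> Y then {i} else {j})" using False by auto
        ultimately have "2 * card ({i + 1..j - 1} \<inter> Y) = Suc (j - 1) - (i + 1)"
          using bal ij by (auto split: if_splits)
        then have "rows_indep Y ({i, j} \<union> {i + 1..j - 1}) M"
          unfolding M_def using mid False U(2)
          by (intro rows_indep_mult rows_indep_pair) (auto simp: ry_coeff_spec_def)
        then show "rows_indep Y {i..j} M" using U(1) by simp
      qed
    qed
    ultimately have "ry_coeff_spec i j H" by (simp add: ry_coeff_spec_def)
    then show ?thesis by blast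
  qed
qed

lemma rows_indep_ry:
  assumes "even (Suc j - i)" "2 * card ({i..j} \<inter> Y) = Suc j - i"
  shows "rows_indep Y {i..j} (mlcoeff (ry i j :: 'a::field polyX))"
proof -
  obtain G :: "nat set \<Rightarrow> (wvar, 'a) mpoly" where "ry_coeff_spec i j G"
    using ry_coeff_spec_exists[OF assms(1)] by blast
  with assms(2) have G: "rows_indep Y {i..j} G" "\<And>A. A \<subseteq> {i..j} \<Longrightarrow> Fract (G A) 1 = mlcoeff (ry i j) A"
    by (auto simp: ry_coeff_spec_def)
  show ?thesis by (rule rows_indep_cong[OF G(2) rows_indep_Fract[OF G(1)]]) simp_all
qed

section \<open>Products over blocks\<close>

definition block :: "nat \<Rightarrow> nat \<Rightarrow> nat set" where
  "block r b = {(b - 1) * r + 1..b * r}"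

text \<open>\<open>pry\<close> with the number of blocks as a parameter, which allows induction on
  it.\<close>

definition ry_prod :: "nat \<Rightarrow> nat \<Rightarrow> 'a::field polyX" where
  "ry_prod r m = (\<Prod>b = 1..m. ry ((b - 1) * r + 1) (b * r))"

definition balanced :: "nat \<Rightarrow> nat \<Rightarrow> nat set \<Rightarrow> bool" where
  "balanced r m Y \<longleftrightarrow> (\<forall>b\<in>{1..m}. 2 * card (block r b \<inter> Y) = r)"

lemma ry_prod_0 [simp]: "ry_prod r 0 = 1"
  by (simp add: ry_prod_def)

lemma ry_prod_Suc: "ry_prod r (Suc m) = ry_prod r m * ry (m * r + 1) (Suc m * r)"
  by (simp add: ry_prod_def)

lemma block_Suc:
  "block r (Suc m) = {m * r + 1..Suc m * r}"
  "{1..Suc m * r} = {1..m * r} \<union> block r (Suc m)"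
  "{1..m * r} \<inter> block r (Suc m) = {}"
  by (auto simp: block_def)

lemma card_block: "card (block r (Suc m)) = r"
  by (simp add: block_def)

lemma balanced_Suc:
  "balanced r (Suc m) Y \<longleftrightarrow> balanced r m Y \<and> 2 * card (block r (Suc m) \<inter> Y) = r"
  by (auto simp: balanced_def le_Suc_eq)

lemma balanced_restrict: "balanced r m (Y \<inter> {1..m * r}) \<longleftrightarrow> balanced r m Y"
proof -
  have "block r b \<subseteq> {1..m * r}" if "b \<in> {1..m}" for b
    using that by (auto simp: block_def intro: order.trans[OF _ mult_le_mono1])
  then have "block r b \<inter> (Y \<inter> {1..m * r}) = block r b \<inter> Y" if "b \<in> {1..m}" for b
    using that by blast
  then show ?thesis by (simp add: balanced_def)
qed

lemma card_balanced: "balanced r m Y \<Longrightarrow> 2 * card ({1..m * r} \<inter> Y) = m * r"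
proof (induction m)
  case (Suc m)
  have "card ({1..Suc m * r} \<inter> Y) = card ({1..m * r} \<inter> Y) + card (block r (Suc m) \<inter> Y)"
    unfolding block_Suc(2) Int_Un_distrib2 using block_Suc(3)[of m r]
    by (intro card_Un_disjoint) (auto simp: block_def)
  with Suc show ?case by (simp add: balanced_Suc)
qed simp

lemma vars_in_ry_prod: "vars_in {1..m * r} (ry_prod r m :: 'a::field polyX)"
proof (induction m)
  case (Suc m)
  have "vars_in {1..Suc m * r} (ry_prod r m * ry (m * r + 1) (Suc m * r) :: 'a polyX)"
    by (intro vars_in_mult vars_in_mono[OF Suc] vars_in_mono[OF vars_in_ry]) auto
  then show ?case by (simp add: ry_prod_Suc)
qed simp

text \<open>Blocks are disjoint, so the matrix is the Kronecker product of the matrices of the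
  blocks, each nonsingular because \<open>Y\<close> halves every block.\<close>

lemma rows_indep_ry_prod:
  assumes "even r" "balanced r m Y"
  shows "rows_indep Y {1..m * r} (mlcoeff (ry_prod r m :: 'a::field polyX))"
  using assms(2)
proof (induction m)
  case 0
  show ?case by (auto intro!: rows_indepI elim!: allE[of _ "{}"] simp: mlcoeff_one)
next
  case (Suc m)
  have 1: "rows_indep Y {1..m * r} (mlcoeff (ry_prod r m :: 'a polyX))"
    using Suc by (simp add: balanced_Suc)
  have "rows_indep Y {m * r + 1..Suc m * r} (mlcoeff (ry (m * r + 1) (Suc m * r) :: 'a polyX))"
    using Suc.prems assms(1) by (intro rows_indep_ry) (simp_all add: balanced_Suc block_Suc(1))
  then have 2: "rows_indep Y (block r (Suc m)) (mlcoeff (ry (m * r + 1) (Suc m * r) :: 'a polyX))"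
    by (simp only: block_Suc(1))
  show ?case
    unfolding block_Suc(2)
  proof (rule rows_indep_cong[OF _ rows_indep_mult[OF 1 2]])
    fix A assume A: "A \<subseteq> {1..m * r} \<union> block r (Suc m)"
    show "mlcoeff (ry_prod r m :: 'a polyX) (A \<inter> {1..m * r}) *
        mlcoeff (ry (m * r + 1) (Suc m * r)) (A \<inter> block r (Suc m)) = mlcoeff (ry_prod r (Suc m)) A"
      unfolding ry_prod_Suc
    proof (rule mlcoeff_mult[symmetric, OF vars_in_ry_prod])
      show "vars_in (block r (Suc m)) (ry (m * r + 1) (Suc m * r) :: 'a polyX)"
        unfolding block_Suc(1) by (rule vars_in_ry)
      show "finite A" using A by (rule finite_subset) (simp add: block_def)
    qed (use A block_Suc(3) in auto)
  qed (use block_Suc(3) in \<open>auto simp: block_def\<close>)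
qed

lemma rank_ry_prod:
  assumes "even r" "balanced r m Y" "rank_le Y K (ry_prod r m :: 'a::field polyX)"
  shows "2 ^ (m * r div 2) \<le> K"
proof -
  have "card ({1..m * r} \<inter> Y) = m * r div 2" using card_balanced[OF assms(2)] by simp
  then show ?thesis
    using rows_indep_rank_le[OF rows_indep_ry_prod[OF assms(1,2)] assms(3)] by simp
qed

section \<open>Counting balanced sets and comparing averages\<close>

text \<open>The traces of a balanced set on the blocks are chosen independently, each as one half of
  its block.\<close>

lemma sum_balanced:
  assumes "even r"
  shows "(\<Sum>Y\<in>Pow {1..m * r}. if balanced r m Y then 1 else (0::nat)) = (r choose (r div 2)) ^ m"
proof (induction m)
  case 0
  show ?case by (simp add: balanced_def)
next
  case (Suc m)
  let ?g = "\<lambda>Y. if balanced r m Y then 1 else (0::nat)"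
  let ?h = "\<lambda>Y. if 2 * card Y = r then 1 else (0::nat)"
  have "(\<Sum>Y\<in>Pow (block r (Suc m)). ?h Y) = card {Y. Y \<subseteq> block r (Suc m) \<and> card Y = r div 2}"
    using assms by (simp add: sum.If_cases block_def Pow_def Collect_conj_eq[symmetric])
      (intro arg_cong[where f = card] Collect_cong, auto)
  also have "\<dots> = r choose (r div 2)"
    by (subst n_subsets) (simp_all add: card_block, simp add: block_def)
  finally have h: "(\<Sum>Y\<in>Pow (block r (Suc m)). ?h Y) = r choose (r div 2)" .
  have "(\<Sum>Y\<in>Pow {1..Suc m * r}. if balanced r (Suc m) Y then 1 else (0::nat)) =
      (\<Sum>Y\<in>Pow ({1..m * r} \<union> block r (Suc m)). ?g (Y \<inter> {1..m * r}) * ?h (Y \<inter> block r (Suc m)))"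
    unfolding block_Suc(2)
    by (intro sum.cong refl) (auto simp: balanced_Suc balanced_restrict[simplified] Int_commute)
  also have "\<dots> = (\<Sum>Y\<in>Pow {1..m * r}. ?g Y) * (\<Sum>Y\<in>Pow (block r (Suc m)). ?h Y)"
    using block_Suc(3) by (intro sum_Pow_disjoint_Un) (auto simp: block_def)
  finally show ?case using Suc h by simp
qed

text \<open>The rank bounds of all summands are added up over all \<open>Y\<close>. Each balanced
  \<open>Y\<close> contributes at least \<open>2 ^ (m * r div 2)\<close> by full rank, whereas each
  summand contributes at most \<open>(14/5) ^ (m * r)\<close> in total.\<close>

lemma number_of_summands:
  fixes f :: "nat \<Rightarrow> 'a::field polyX"
  assumes "even r" and ro: "\<And>i. i \<in> {1..s} \<Longrightarrow> read_once_poly {1..m * r} (f i)"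
    and eq: "ry_prod r m = (\<Sum>i=1..s. f i)"
  shows "real (r choose (r div 2)) ^ m * 2 ^ (m * r div 2) \<le> real s * (14/5) ^ (m * r)"
proof -
  have "\<forall>i\<in>{1..s}. \<exists>T. (\<forall>Y. rank_le Y (T Y) (f i)) \<and> real (\<Sum>Y\<in>Pow {1..m * r}. T Y) \<le> (14/5) ^ (m * r)"
    using read_once_poly_average_rank[OF ro] by simp
  from bchoice[OF this] obtain T where
    "\<forall>i\<in>{1..s}. (\<forall>Y. rank_le Y (T i Y) (f i)) \<and> real (\<Sum>Y\<in>Pow {1..m * r}. T i Y) \<le> (14/5) ^ (m * r)" ..
  then have T: "\<And>i Y. i \<in> {1..s} \<Longrightarrow> rank_le Y (T i Y) (f i)"
    "\<And>i. i \<in> {1..s} \<Longrightarrow> real (\<Sum>Y\<in>Pow {1..m * r}. T i Y) \<le> (14/5) ^ (m * r)"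
    by simp_all
  have rank: "rank_le Y (\<Sum>i=1..s. T i Y) (ry_prod r m :: 'a polyX)" for Y
    unfolding eq using T(1) by (intro rank_le_sum) auto
  have "(r choose (r div 2)) ^ m * 2 ^ (m * r div 2) =
      (\<Sum>Y\<in>Pow {1..m * r}. (if balanced r m Y then 1 else 0) * 2 ^ (m * r div 2))"
    using sum_balanced[OF assms(1), of m] by (simp only: sum_distrib_right[symmetric])
  also have "\<dots> \<le> (\<Sum>Y\<in>Pow {1..m * r}. \<Sum>i=1..s. T i Y)"
    using rank_ry_prod[OF assms(1) _ rank] by (intro sum_mono) auto
  also have "\<dots> = (\<Sum>i=1..s. \<Sum>Y\<in>Pow {1..m * r}. T i Y)" by (rule sum.swap)
  finally have "real ((r choose (r div 2)) ^ m * 2 ^ (m * r div 2)) \<le>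
      (\<Sum>i=1..s. real (\<Sum>Y\<in>Pow {1..m * r}. T i Y))"
    by (simp only: of_nat_le_iff flip: of_nat_sum)
  also have "\<dots> \<le> real s * (14/5) ^ (m * r)"
    using sum_mono[OF T(2), of "{1..s}"] by simp
  finally show ?thesis by simp
qed

section \<open>Read-\<open>k\<close> formulas\<close>

lemma read_computable_mono:
  assumes "read_computable k X f" "k \<le> l" "X \<subseteq> Y"
  shows "read_computable l Y f"
proof -
  obtain p where p: "read_formula k X p" "poly_of p = f"
    using assms(1) unfolding read_computable_def by blast
  have "read_formula l Y p"
    using p(1) assms(2,3) by (auto simp: read_formula_def intro: order.trans)
  with p(2) show ?thesis unfolding read_computable_def by blast
qed

lemma read_computable_mconst: "read_computable k X (mconst c)"
  unfolding read_computable_def read_formula_def by (rule exI[of _ "Const c"]) simp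

lemma read_computable_one: "read_computable k X (1 :: ('v, 'c::comm_ring_1) mpoly)"
  using read_computable_mconst[of k X 1] by (simp add: mconst_def)

lemma read_computable_mvar: "v \<in> X \<Longrightarrow> read_computable 1 X (mvar v)"
  unfolding read_computable_def read_formula_def by (rule exI[of _ "Var v"]) simp

lemma read_computable_add:
  assumes "read_computable k X f" "read_computable l X g"
  shows "read_computable (k + l) X (f + g)"
proof -
  obtain p q where "read_formula k X p" "poly_of p = f" "read_formula l X q" "poly_of q = g"
    using assms unfolding read_computable_def by blast
  then show ?thesis unfolding read_computable_def
    by (intro exI[of _ "Add p q"]) (auto simp: read_formula_def intro: add_mono)
qed

lemma read_computable_mult:
  assumes "read_computable k X f" "read_computable l X g"
  shows "read_computable (k + l) X (f * g)"
proof -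
  obtain p q where "read_formula k X p" "poly_of p = f" "read_formula l X q" "poly_of q = g"
    using assms unfolding read_computable_def by blast
  then show ?thesis unfolding read_computable_def
    by (intro exI[of _ "Mult p q"]) (auto simp: read_formula_def intro: add_mono)
qed

text \<open>No variable occurs in both factors, so the leaf counts do not add up. This keeps
  \<open>k\<close> independent of the number of blocks.\<close>

lemma read_computable_mult_disjoint:
  assumes "read_computable k X f" "read_computable k Y g" "X \<inter> Y = {}"
  shows "read_computable k (X \<union> Y) (f * g)"
proof -
  obtain p q where pq: "read_formula k X p" "poly_of p = f" "read_formula k Y q" "poly_of q = g"
    using assms unfolding read_computable_def by blast
  have "leaf_count x p + leaf_count x q \<le> k" for x
  proof -
    have "x \<notin> set1_formula p \<or> x \<notin> set1_formula q"
      using pq assms(3) unfolding read_formula_def by blast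
    then have "leaf_count x p = 0 \<or> leaf_count x q = 0" using leaf_count_pos_iff by fastforce
    then show ?thesis using pq by (auto simp: read_formula_def)
  qed
  with pq show ?thesis unfolding read_computable_def
    by (intro exI[of _ "Mult p q"]) (auto simp: read_formula_def)
qed

lemma read_computable_sum:
  fixes f :: "'i \<Rightarrow> ('v, 'c::comm_ring_1) mpoly"
  shows "finite I \<Longrightarrow> (\<And>i. i \<in> I \<Longrightarrow> read_computable k X (f i)) \<Longrightarrow>
    read_computable (card I * k) X (\<Sum>i\<in>I. f i)"
proof (induction I rule: finite_induct)
  case empty
  show ?case using read_computable_mconst[of 0 X 0] by (simp add: mconst_def)
next
  case (insert x I)
  then have "read_computable (k + card I * k) X (f x + (\<Sum>i\<in>I. f i))"
    by (intro read_computable_add) auto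
  with insert show ?case by simp
qed

text \<open>Unfolding the recursion into a formula is costly in the length of the interval, but that
  length is bounded by \<open>N\<close>.\<close>

lemma read_computable_ry:
  "\<exists>k. \<forall>i j. Suc j - i \<le> N \<longrightarrow> read_computable k {i..j} (ry i j :: 'a::field polyX)"
proof (induction N)
  case 0
  show ?case by (intro exI[of _ 0]) (simp add: ry_empty read_computable_one)
next
  case (Suc N)
  then obtain k where k: "\<And>i j. Suc j - i \<le> N \<Longrightarrow> read_computable k {i..j} (ry i j :: 'a polyX)" by blast
  \<comment> \<open>The bound follows the recursion: 0 for the constant 1, \<open>1 + 1\<close> for
    the two variables, \<open>k\<close> for the inner interval, and at most \<open>Suc N\<close>
    splits with a constant and two subintervals each.\<close>
  have "read_computable (0 + (1 + 1) + k + Suc N * (0 + (k + k))) {i..j} (ry i j :: 'a polyX)"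
    if le: "Suc j - i \<le> Suc N" for i j
  proof (cases "i \<le> j")
    case False
    then show ?thesis by (simp add: ry_empty read_computable_one)
  next
    case True
    have sub: "read_computable k {i..j} (ry i' j' :: 'a polyX)"
      if "Suc j' - i' < Suc j - i" "i \<le> i'" "j' \<le> j" for i' j'
      using that le by (intro read_computable_mono[OF k order.refl]) auto
    have "card (ry_splits i j) \<le> card {i<..<j}"
      by (intro card_mono) (auto simp: ry_splits_def)
    also have "\<dots> \<le> Suc N" using le by simp
    finally have card: "card (ry_splits i j) * (0 + (k + k)) \<le> Suc N * (0 + (k + k))"
      by (rule mult_le_mono1)
    have "read_computable (card (ry_splits i j) * (0 + (k + k))) {i..j}
        (\<Sum>l\<in>ry_splits i j. mconst (wcoeff i l j) * (ry i l * ry (l + 1) j) :: 'a polyX)"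
      by (intro read_computable_sum read_computable_mult read_computable_mconst sub finite_ry_splits)
        (auto simp: ry_splits_def)
    then have sum: "read_computable (Suc N * (0 + (k + k))) {i..j}
        (\<Sum>l\<in>ry_splits i j. mconst (wcoeff i l j) * (ry i l * ry (l + 1) j) :: 'a polyX)"
      by (rule read_computable_mono[OF _ card order.refl])
    show ?thesis
      unfolding ry_rec[OF True]
      by (intro read_computable_add read_computable_mult read_computable_one read_computable_mvar sub sum)
        (use True in auto)
  qed
  then show ?case by blast
qed

lemma read_computable_ry_prod:
  "\<exists>k. \<forall>m. read_computable k {1..m * r} (ry_prod r m :: 'a::field polyX)"
proof -
  obtain k where k: "\<And>i j. Suc j - i \<le> r \<Longrightarrow> read_computable k {i..j} (ry i j :: 'a polyX)"
    using read_computable_ry[of r] by blast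
  have "read_computable k {1..m * r} (ry_prod r m :: 'a polyX)" for m
  proof (induction m)
    case 0
    show ?case by (simp add: read_computable_one)
  next
    case (Suc m)
    have "read_computable k ({1..m * r} \<union> block r (Suc m)) (ry_prod r m * ry (m * r + 1) (Suc m * r) :: 'a polyX)"
      using Suc block_Suc(3) unfolding block_Suc(1)
      by (intro read_computable_mult_disjoint k) auto
    then show ?case unfolding block_Suc(2) ry_prod_Suc .
  qed
  then show ?thesis by blast
qed

section \<open>Exponential growth\<close>

text \<open>\<open>50/49\<close> is 2 divided by the square of \<open>7/5\<close>, the gain per two
  variables. For long blocks it outweighs the loss \<open>2 * t\<close> incurred by requiring a
  block of length \<open>2 * t\<close> to be balanced.\<close>

lemma exponential_dominates: "\<exists>t0. \<forall>t\<ge>t0. 1 \<le> t \<and> 2 * real t < (50/49) ^ t"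
proof -
  have "(\<lambda>n. real n / (50/49) ^ n) \<longlonglongrightarrow> 0"
    by (rule lim_n_over_pown) simp
  then have "eventually (\<lambda>n. real n / (50/49) ^ n < 1/2) sequentially"
    by (rule order_tendstoD) simp
  then obtain t0 where t0: "\<And>t. t0 \<le> t \<Longrightarrow> real t / (50/49) ^ t < 1/2"
    unfolding eventually_sequentially by blast
  have "2 * real t < (50/49) ^ t" if "t0 \<le> t" for t
  proof -
    have "real t < 1/2 * (50/49) ^ t"
      using t0[OF that] by (subst (asm) pos_divide_less_eq) simp_all
    then show ?thesis by linarith
  qed
  then show ?thesis by (intro exI[of _ "max 1 t0"]) simp
qed

text \<open>Blockwise comparison using \<open>4 ^ t / (2 * t)\<close> as a lower bound for the
  central binomial coefficient, followed by division by the \<open>m\<close>-th power of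
  \<open>R\<close>.\<close>

lemma exponential_lower_bound:
  fixes s m t :: nat
  assumes "1 \<le> t"
    and "real ((2 * t) choose t) ^ m * 2 ^ (m * t) \<le> real s * (14/5) ^ (m * (2 * t))"
  shows "((50/49) ^ t / (2 * real t)) ^ m \<le> real s"
proof -
  define Q :: real where "Q = (50/49) ^ t / (2 * real t)"
  define R :: real where "R = (14/5) ^ (2 * t)"
  have pow: "x ^ (m * k) = (x ^ k) ^ m" for x :: real and k
    by (subst mult.commute) (rule power_mult)
  \<comment> \<open>Because \<open>(14/5)^2 * (50/49) = 8\<close>.\<close>
  have "R * (50/49) ^ t = 4 ^ t * 2 ^ t"
    unfolding R_def power_mult by (simp flip: power_mult_distrib) (simp add: power2_eq_square)
  then have "R * Q = 4 ^ t / (2 * real t) * 2 ^ t" by (simp add: Q_def)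
  also have "\<dots> \<le> real ((2 * t) choose t) * 2 ^ t"
    using central_binomial_lower_bound[of t] assms(1) by (intro mult_right_mono) simp_all
  finally have "(R * Q) ^ m \<le> (real ((2 * t) choose t) * 2 ^ t) ^ m"
    by (intro power_mono) (simp_all add: R_def Q_def)
  also have "\<dots> \<le> real s * R ^ m"
    using assms(2) unfolding R_def pow power_mult_distrib .
  finally have "R ^ m * Q ^ m \<le> R ^ m * real s"
    by (simp only: power_mult_distrib mult.commute)
  moreover have "0 < R ^ m" by (simp add: R_def)
  ultimately have "Q ^ m \<le> real s" by (rule mult_left_le_imp_le)
  then show ?thesis by (simp only: Q_def)
qed

section \<open>Choice of the block length and of the rate in the exponent\<close>

theorem mainTheorem1:
  "\<exists>r0::nat. \<forall>r\<ge>r0. even r \<longrightarrow>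
     (\<exists>k. \<forall>n. 4 dvd n \<and> r dvd n \<and> even (n div r) \<longrightarrow>
        read_computable k {1..n} (pry r n :: 'a::field polyX)) \<and>
     (\<exists>c>0::real. \<exists>n0. \<forall>n\<ge>n0. 4 dvd n \<and> r dvd n \<and> even (n div r) \<longrightarrow>
        (\<forall>s. \<forall>f :: nat \<Rightarrow> 'a polyX.
           (\<forall>i\<in>{1..s}. read_once_poly {1..n} (f i)) \<and> pry r n = (\<Sum>i=1..s. f i)
             \<longrightarrow> 2 powr (c * real n) \<le> real s))"
proof -
  obtain t0 where t0: "\<And>t. t0 \<le> t \<Longrightarrow> 1 \<le> t \<and> 2 * real t < (50/49) ^ t"
    using exponential_dominates by blast
  show ?thesis
  proof (rule exI[of _ "2 * t0"], intro allI impI conjI)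
    fix r :: nat
    assume r: "2 * t0 \<le> r" "even r"
    then obtain t where t: "r = 2 * t" by blast
    with r t0[of t] have t1: "1 \<le> t" "2 * real t < (50/49) ^ t" by auto
    have pry: "n = (n div r) * r" "pry r n = (ry_prod r (n div r) :: 'a polyX)" if "r dvd n" for n
      using that by (auto simp: pry_def ry_prod_def)
    obtain k where k: "\<And>m. read_computable k {1..m * r} (ry_prod r m :: 'a polyX)"
      using read_computable_ry_prod[of r] by blast
    show "\<exists>k. \<forall>n. 4 dvd n \<and> r dvd n \<and> even (n div r) \<longrightarrow> read_computable k {1..n} (pry r n :: 'a polyX)"
    proof (intro exI[of _ k] allI impI)
      fix n assume "4 dvd n \<and> r dvd n \<and> even (n div r)"
      then have n: "r dvd n" by simp
      show "read_computable k {1..n} (pry r n :: 'a polyX)"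
        using k[of "n div r"] unfolding pry(2)[OF n] pry(1)[OF n, symmetric] .
    qed
    \<comment> \<open>The growth factor per block; it exceeds 1 by the choice of
      \<open>t0\<close>.\<close>
    define q where "q = (50/49) ^ t / (2 * real t)"
    have q: "1 < q" using t1 by (simp add: q_def field_simps)
    \<comment> \<open>Chosen so that \<open>2 powr (c * n)\<close> is \<open>q\<close> to the number
      of blocks; it depends only on \<open>r\<close>.\<close>
    define c where "c = log 2 q / real r"
    have "2 powr (c * real n) \<le> real s"
      if n: "r dvd n" and f: "\<forall>i\<in>{1..s}. read_once_poly {1..n} (f i)" "pry r n = (\<Sum>i=1..s. f i)"
      for n s and f :: "nat \<Rightarrow> 'a polyX"
    proof -
      define m where "m = n div r"
      have nm: "n = m * r" using pry(1)[OF n] by (simp add: m_def)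
      have "real (r choose (r div 2)) ^ m * 2 ^ (m * r div 2) \<le> real s * (14/5) ^ (m * r)"
      proof (rule number_of_summands[OF r(2)])
        show "read_once_poly {1..m * r} (f i)" if "i \<in> {1..s}" for i
          using f(1) that unfolding nm by blast
        show "ry_prod r m = (\<Sum>i = 1..s. f i)"
          using f(2) unfolding pry(2)[OF n] m_def .
      qed
      moreover have "m * r div 2 = m * t" by (simp add: t)
      ultimately have "q ^ m \<le> real s"
        unfolding q_def t by (intro exponential_lower_bound[OF t1(1)]) simp
      moreover have "2 powr (c * real n) = q ^ m"
      proof -
        have "c * real n = log 2 q * real m" using t t1 by (simp add: c_def nm)
        then have "2 powr (c * real n) = (2 powr log 2 q) powr real m" by (simp add: powr_powr)
        then show ?thesis using q by (simp add: powr_realpow)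
      qed
      ultimately show ?thesis by simp
    qed
    moreover have "0 < c" using q t t1 by (simp add: c_def)
    ultimately show "\<exists>c>0::real. \<exists>n0. \<forall>n\<ge>n0. 4 dvd n \<and> r dvd n \<and> even (n div r) \<longrightarrow>
        (\<forall>s. \<forall>f :: nat \<Rightarrow> 'a polyX.
           (\<forall>i\<in>{1..s}. read_once_poly {1..n} (f i)) \<and> pry r n = (\<Sum>i=1..s. f i)
             \<longrightarrow> 2 powr (c * real n) \<le> real s)"
      by (intro exI[of _ c] conjI exI[of _ "0::nat"]) auto
  qed
qed

end
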